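(* Let $c = \frac{1}{100}$. For every $\epsilon > 0$ there exists $n_0(\epsilon)$ such that for all $n \geq n_0(\epsilon)$ the following holds. If $G$ is a graph on $n$ vertices that is $\epsilon$-far from every disjoint union of cliques, then $$\mathsf{sp}(G) \geq n^{1 + c}.$$
   Context: Graphs are finite, simple and undirected. For a graph $G$ with $m$ edges, the max-cut $\mathsf{mc}(G)$ is the largest number of edges in a bipartite subgraph of $G$, and the surplus is $\mathsf{sp}(G) = \mathsf{mc}(G) - \frac{m}{2}$. Two graphs $G$ and $H$ on $n$ vertices are $\epsilon$-close if starting from $G$ one can obtain a graph isomorphic to $H$ by adding or removing at most $\epsilon n^2$ edges; otherwise they are $\epsilon$-far. "$\epsilon$-far from every disjoint union of cliques" means $\epsilon$-far from every graph on $n$ vertices each of whose connected components is a complete graph. *)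

theory Defs
  imports Complex_Main
begin

record 'a graph =
  verts :: "'a set"
  edges :: "'a set set"

definition simple_graph :: "'a graph \<Rightarrow> bool" where
  "simple_graph G \<longleftrightarrow> finite (verts G) \<and> (\<forall>e\<in>edges G. e \<subseteq> verts G \<and> card e = 2)"

definition subgraph_of :: "'a graph \<Rightarrow> 'a graph \<Rightarrow> bool" where
  "subgraph_of H G \<longleftrightarrow> simple_graph H \<and> verts H \<subseteq> verts G \<and> edges H \<subseteq> edges G"

definition bipartite :: "'a graph \<Rightarrow> bool" where
  "bipartite G \<longleftrightarrow> (\<exists>A B. A \<union> B = verts G \<and> A \<inter> B = {} \<and>
     (\<forall>e\<in>edges G. \<exists>a\<in>A. \<exists>b\<in>B. e = {a, b}))"

definition max_cut :: "'a graph \<Rightarrow> nat" where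
  "max_cut G = Max {card (edges H) | H. subgraph_of H G \<and> bipartite H}"

definition surplus :: "'a graph \<Rightarrow> real" where
  "surplus G = real (max_cut G) - real (card (edges G)) / 2"

definition isomorphic :: "'a graph \<Rightarrow> 'b graph \<Rightarrow> bool" where
  "isomorphic G H \<longleftrightarrow> (\<exists>f. bij_betw f (verts G) (verts H) \<and> edges H = (\<lambda>e. f ` e) ` edges G)"

text \<open>In the next definition \<open>edges G' - edges G\<close> are the added edges and
  \<open>edges G - edges G'\<close> the removed ones.\<close>

definition eps_close :: "real \<Rightarrow> 'a graph \<Rightarrow> 'b graph \<Rightarrow> bool" where
  "eps_close \<epsilon> G H \<longleftrightarrow> (\<exists>G'. simple_graph G' \<and> verts G' = verts G \<and>
     real (card (edges G' - edges G) + card (edges G - edges G')) \<le> \<epsilon> * (real (card (verts G)))\<^sup>2 \<and>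
     isomorphic G' H)"

abbreviation eps_far :: "real \<Rightarrow> 'a graph \<Rightarrow> 'b graph \<Rightarrow> bool" where
  "eps_far \<epsilon> G H \<equiv> \<not> eps_close \<epsilon> G H"

definition adj_rel :: "'a graph \<Rightarrow> 'a rel" where
  "adj_rel G = {(u, v). {u, v} \<in> edges G}"

definition component_of :: "'a graph \<Rightarrow> 'a \<Rightarrow> 'a set" where
  "component_of G v = {u. (v, u) \<in> (adj_rel G)\<^sup>*}"

definition induced_subgraph :: "'a graph \<Rightarrow> 'a set \<Rightarrow> 'a graph" where
  "induced_subgraph G C = \<lparr>verts = C, edges = {e \<in> edges G. e \<subseteq> C}\<rparr>"

definition connected_components :: "'a graph \<Rightarrow> 'a graph set" where
  "connected_components G = (\<lambda>v. induced_subgraph G (component_of G v)) ` verts G"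

definition complete_graph :: "'a graph \<Rightarrow> bool" where
  "complete_graph G \<longleftrightarrow> edges G = {{u, v} | u v. u \<in> verts G \<and> v \<in> verts G \<and> u \<noteq> v}"

definition disjoint_union_of_cliques :: "'a graph \<Rightarrow> bool" where
  "disjoint_union_of_cliques G \<longleftrightarrow>
     simple_graph G \<and> (\<forall>K\<in>connected_components G. complete_graph K)"

end

theory Submission
  imports Defs "HOL-Analysis.Function_Topology" "HOL-Analysis.Convex" "HOL-Real_Asymp.Real_Asymp"
begin

text \<open>
  Call an ordered triple \<open>(i, j, k)\<close> with \<open>i \<sim> j \<sim> k\<close> and \<open>i\<close>, \<open>k\<close> distinct and non-adjacent a cherry. A graph with
  few cherries is close to a disjoint union of cliques: repeatedly split off the closed neighbourhood of
  a vertex that lies in few cherries relative to its degree.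

  The heart of the matter is spectral. Let \<open>A\<close> be the adjacency matrix of a graph on \<open>N\<close> vertices with
  \<open>B = A + \<mu>I\<close> positive semidefinite and \<open>\<mu>\<^sup>6 \<le> N\<close>. If \<open>C\<close> is a spectral truncation of \<open>B\<close> of rank \<open>r\<close>,
  then by the Schur product theorem the Hadamard square \<open>C \<circ> C\<close>, which has rank at most \<open>r\<^sup>2\<close>, is dominated by
  \<open>B \<circ> B = A + \<mu>\<^sup>2I\<close>, while its trace is at least \<open>(tr C)\<^sup>2/N\<close>. So if the large eigenvalues of \<open>B\<close> had a large
  sum, then iterating would force the total trace above \<open>\<mu>N\<close>. Hence the eigenvalues decay, \<open>A\<close> is close
  in Frobenius norm to a positive semidefinite matrix \<open>C \<le> B\<close> of bounded rank, that is, to inner products of vectors in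
  a space of bounded dimension. By pigeonhole most of these vectors have norm at most about 1, for
  otherwise a large cluster of them would violate \<open>C \<le> A + \<mu>I\<close>; then inner product close to 1 means
  close together, which is a transitive relation, and there are few cherries.

  Consequently, if \<open>G\<close> is far from all disjoint unions of cliques, then every large vertex set carries a
  unit vector \<open>x\<close> with \<open>x\<^sup>TAx \<le> -n\<^bsup>1/8\<^esup>\<close>. Collecting linearly many such vectors with bounded total mass
  at every vertex and adding them with suitable signs gives a vector with logarithmically bounded entries on
  which the form is at most \<open>-\<Omega>(n\<^bsup>9/8\<^esup>)\<close>; rescaled and rounded to signs it is the required cut.
\<close>


section \<open>Orthonormal systems and the spectral theorem\<close>

definition ip :: "'a set \<Rightarrow> ('a \<Rightarrow> real) \<Rightarrow> ('a \<Rightarrow> real) \<Rightarrow> real" where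
  "ip V f g = (\<Sum>i\<in>V. f i * g i)"

definition orthonormal_on :: "'a set \<Rightarrow> nat \<Rightarrow> (nat \<Rightarrow> 'a \<Rightarrow> real) \<Rightarrow> bool" where
  "orthonormal_on V k x \<longleftrightarrow> (\<forall>a<k. \<forall>b<k. ip V (x a) (x b) = of_bool (a = b))"

definition quad_form :: "'a set \<Rightarrow> ('a \<Rightarrow> 'a \<Rightarrow> real) \<Rightarrow> ('a \<Rightarrow> real) \<Rightarrow> real" where
  "quad_form V A z = (\<Sum>i\<in>V. \<Sum>j\<in>V. A i j * z i * z j)"

lemma ip_commute: "ip V f g = ip V g f"
  by (simp add: ip_def mult.commute)

lemma ip_self_nonneg: "0 \<le> ip V f f"
  by (simp add: ip_def sum_nonneg)

lemma ip_self_eq_0: "finite V \<Longrightarrow> ip V f f = 0 \<Longrightarrow> i \<in> V \<Longrightarrow> f i = 0"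
  by (simp add: ip_def sum_nonneg_eq_0_iff)

lemma ip_add_left: "ip V (\<lambda>i. f i + g i) h = ip V f h + ip V g h"
  by (simp add: ip_def sum.distrib algebra_simps)

lemma ip_diff_left: "ip V (\<lambda>i. f i - g i) h = ip V f h - ip V g h"
  by (simp add: ip_def sum_subtractf algebra_simps)

lemma ip_scale_left: "ip V (\<lambda>i. c * f i) h = c * ip V f h"
  by (simp add: ip_def sum_distrib_left algebra_simps)

lemma ip_sum_left: "ip V (\<lambda>i. \<Sum>a\<in>S. f a i) h = (\<Sum>a\<in>S. ip V (f a) h)"
  unfolding ip_def by (subst sum.swap) (simp add: sum_distrib_right)

lemma ip_add_right: "ip V h (\<lambda>i. f i + g i) = ip V h f + ip V h g"
  by (simp add: ip_def sum.distrib algebra_simps)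

lemma ip_diff_right: "ip V h (\<lambda>i. f i - g i) = ip V h f - ip V h g"
  by (simp add: ip_def sum_subtractf algebra_simps)

lemma ip_scale_right: "ip V h (\<lambda>i. c * f i) = c * ip V h f"
  by (simp add: ip_def sum_distrib_left algebra_simps)

lemma ip_sum_right: "ip V h (\<lambda>i. \<Sum>a\<in>S. f a i) = (\<Sum>a\<in>S. ip V h (f a))"
  by (simp add: ip_commute[of V h] ip_sum_left)

lemmas ip_linear = ip_add_left ip_diff_left ip_scale_left ip_sum_left
  ip_add_right ip_diff_right ip_scale_right ip_sum_right

lemma ip_cong: "(\<And>i. i \<in> V \<Longrightarrow> f i = f' i) \<Longrightarrow> (\<And>i. i \<in> V \<Longrightarrow> g i = g' i) \<Longrightarrow> ip V f g = ip V f' g'"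
  by (simp add: ip_def)

lemma sum_orthonormal:
  assumes "orthonormal_on V k x" "b < k"
  shows "(\<Sum>a<k. c a * ip V (x a) (x b)) = c b"
proof -
  have "(\<Sum>a<k. c a * ip V (x a) (x b)) = (\<Sum>a<k. if a = b then c a else 0)"
    using assms by (intro sum.cong) (auto simp: orthonormal_on_def)
  then show ?thesis using assms(2) by simp
qed

text \<open>Pythagoras for the orthogonal projection onto the span of the system. Bessel's
  inequality and the induction step of Gram-Schmidt are both read off from it.\<close>

lemma ip_residual:
  assumes "orthonormal_on V k x"
  shows "ip V (\<lambda>i. z i - (\<Sum>a<k. ip V (x a) z * x a i)) (\<lambda>i. z i - (\<Sum>a<k. ip V (x a) z * x a i))
     = ip V z z - (\<Sum>a<k. (ip V (x a) z)\<^sup>2)"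
proof -
  have 1: "ip V (\<lambda>i. \<Sum>a<k. ip V (x a) z * x a i) (\<lambda>i. \<Sum>a<k. ip V (x a) z * x a i)
    = (\<Sum>b<k. (ip V (x b) z)\<^sup>2)"
  proof -
    have "ip V (\<lambda>i. \<Sum>a<k. ip V (x a) z * x a i) (\<lambda>i. \<Sum>a<k. ip V (x a) z * x a i)
       = (\<Sum>b<k. ip V (x b) z * (\<Sum>a<k. ip V (x a) z * ip V (x a) (x b)))"
      by (simp only: ip_sum_right ip_scale_right ip_sum_left ip_scale_left)
    also have "\<dots> = (\<Sum>b<k. (ip V (x b) z)\<^sup>2)"
      by (intro sum.cong) (simp_all add: sum_orthonormal[OF assms] power2_eq_square)
    finally show ?thesis .
  qed
  show ?thesis
    by (simp add: ip_diff_left ip_diff_right 1)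
       (simp add: ip_linear ip_commute[of V z] power2_eq_square)
qed

lemma bessel_inequality:
  assumes "orthonormal_on V k x"
  shows "(\<Sum>a<k. (ip V (x a) z)\<^sup>2) \<le> ip V z z"
  using ip_residual[OF assms, of z] ip_self_nonneg[of V "\<lambda>i. z i - (\<Sum>a<k. ip V (x a) z * x a i)"] by linarith

lemma ip_residual_orthogonal:
  assumes "orthonormal_on V k x" "b < k"
  shows "ip V (\<lambda>i. z i - (\<Sum>a<k. ip V (x a) z * x a i)) (x b) = 0"
  using sum_orthonormal[OF assms, of "\<lambda>a. ip V (x a) z"]
  by (simp add: ip_diff_left ip_sum_left ip_scale_left ip_commute[of V z])

lemma ip_normalise:
  assumes "ip V r r > 0"
  shows "ip V (\<lambda>i. (1 / sqrt (ip V r r)) * r i) (\<lambda>i. (1 / sqrt (ip V r r)) * r i) = 1"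
proof -
  have "ip V r r = sqrt (ip V r r) * sqrt (ip V r r)" using assms by simp
  then show ?thesis
    unfolding ip_scale_left ip_scale_right using assms
    by (simp add: field_simps del: real_sqrt_mult_self)
qed

lemma orthonormal_on_extend:
  assumes "orthonormal_on V k x" "ip V w w = 1" "\<And>a. a < k \<Longrightarrow> ip V w (x a) = 0"
  shows "orthonormal_on V (Suc k) (x(k := w))"
  using assms by (auto simp: orthonormal_on_def less_Suc_eq ip_commute)

lemma ip_indicator_right:
  "finite V \<Longrightarrow> i \<in> V \<Longrightarrow> ip V z (\<lambda>j. of_bool (j = i)) = z i"
  by (simp add: ip_def of_bool_def if_distrib cong: if_cong)

text \<open>The trace of the projection onto the orthogonal complement, computed in the standard
  basis. It stands in for dimension theory: the value 0 at \<open>k = card V\<close> makes the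
  system complete, and a positive value for \<open>k < card V\<close> yields a vector outside the
  span.\<close>

lemma sum_residuals_indicator:
  assumes "finite V" "orthonormal_on V k x"
  shows "(\<Sum>i\<in>V. ip V (\<lambda>j. of_bool (j = i)) (\<lambda>j. of_bool (j = i))
      - (\<Sum>a<k. (ip V (x a) (\<lambda>j. of_bool (j = i)))\<^sup>2)) = real (card V) - real k"
proof -
  have "(\<Sum>i\<in>V. \<Sum>a<k. (x a i)\<^sup>2) = (\<Sum>a<k. ip V (x a) (x a))"
    by (subst sum.swap) (simp add: ip_def power2_eq_square)
  also have "\<dots> = real k" using assms(2) by (simp add: orthonormal_on_def)
  finally show ?thesis using assms by (simp add: ip_indicator_right sum_subtractf)
qed

lemma orthonormal_complete:
  assumes "finite V" "orthonormal_on V (card V) x" "i \<in> V" "j \<in> V"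
  shows "(\<Sum>a<card V. x a i * x a j) = of_bool (j = i)"
proof -
  let ?e = "\<lambda>i j. of_bool (j = i) :: real"
  let ?r = "\<lambda>i. \<lambda>j. ?e i j - (\<Sum>a<card V. ip V (x a) (?e i) * x a j)"
  have "(\<Sum>i\<in>V. ip V (?r i) (?r i)) = 0"
    using sum_residuals_indicator[OF assms(1,2)] by (simp add: ip_residual[OF assms(2)])
  then have "ip V (?r i) (?r i) = 0"
    using assms(1,3) by (simp add: sum_nonneg_eq_0_iff ip_self_nonneg)
  then have "?r i j = 0" using ip_self_eq_0[OF assms(1)] assms(4) by blast
  then show ?thesis using assms by (simp add: ip_indicator_right)
qed

lemma exists_unit_orthogonal:
  assumes "finite V" "orthonormal_on V k x" "k < card V"
  shows "\<exists>w. ip V w w = 1 \<and> (\<forall>a<k. ip V w (x a) = 0)"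
proof -
  let ?e = "\<lambda>i j. of_bool (j = i) :: real"
  let ?r = "\<lambda>i. \<lambda>j. ?e i j - (\<Sum>a<k. ip V (x a) (?e i) * x a j)"
  have "(\<Sum>i\<in>V. ip V (?r i) (?r i)) > 0"
    using sum_residuals_indicator[OF assms(1,2)] assms(3) by (simp add: ip_residual[OF assms(2)])
  then obtain i where i: "i \<in> V" "ip V (?r i) (?r i) > 0"
    by (metis (no_types, lifting) not_less sum_nonpos)
  let ?w = "\<lambda>j. (1 / sqrt (ip V (?r i) (?r i))) * ?r i j"
  have "ip V ?w ?w = 1" by (rule ip_normalise[OF i(2)])
  moreover have "ip V ?w (x a) = 0" if "a < k" for a
    unfolding ip_scale_left ip_residual_orthogonal[OF assms(2) that] by simp
  ultimately show ?thesis by blast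
qed

text \<open>Equality in Bessel's inequality expresses that \<open>y m\<close> lies in the span of
  the \<open>u a\<close>. The bound \<open>q \<le> card M\<close> later bounds the rank of a
  Hadamard square.\<close>

lemma gram_schmidt:
  assumes "finite V" "finite M"
  shows "\<exists>q u. q \<le> card M \<and> orthonormal_on V q u \<and>
    (\<forall>m\<in>M. ip V (y m) (y m) = (\<Sum>a<q. (ip V (u a) (y m))\<^sup>2))"
  using assms(2)
proof (induction M rule: finite_induct)
  case empty
  show ?case by (intro exI[of _ 0]) (simp add: orthonormal_on_def)
next
  case (insert m M)
  then obtain q u where qu: "q \<le> card M" "orthonormal_on V q u"
    "\<And>m. m \<in> M \<Longrightarrow> ip V (y m) (y m) = (\<Sum>a<q. (ip V (u a) (y m))\<^sup>2)" by blast
  define r where "r = (\<lambda>i. y m i - (\<Sum>a<q. ip V (u a) (y m) * u a i))"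
  have rr: "ip V r r = ip V (y m) (y m) - (\<Sum>a<q. (ip V (u a) (y m))\<^sup>2)"
    unfolding r_def by (rule ip_residual[OF qu(2)])
  show ?case
  proof (cases "ip V r r = 0")
    case True
    then show ?thesis using qu rr insert by (intro exI[of _ q] exI[of _ u]) auto
  next
    case False
    then have pos: "ip V r r > 0" using ip_self_nonneg[of V r] by linarith
    define w where "w = (\<lambda>j. (1 / sqrt (ip V r r)) * r j)"
    have ort: "ip V r (u a) = 0" if "a < q" for a
      unfolding r_def by (rule ip_residual_orthogonal[OF qu(2) that])
    have o: "orthonormal_on V (Suc q) (u(q := w))"
      by (rule orthonormal_on_extend[OF qu(2)])
         (simp_all only: w_def ip_normalise[OF pos], simp only: ip_scale_left ort mult_zero_right)
    have "ip V (y m') (y m') = (\<Sum>a<Suc q. (ip V ((u(q := w)) a) (y m'))\<^sup>2)" if "m' \<in> insert m M" for m'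
    proof (cases "m' = m")
      case True
      have "ip V r r = ip V r (\<lambda>i. y m i - (\<Sum>a<q. ip V (u a) (y m) * u a i))"
        by (subst (2) r_def) (rule refl)
      also have "\<dots> = ip V r (y m) - (\<Sum>a<q. ip V (u a) (y m) * ip V r (u a))"
        by (simp only: ip_diff_right ip_sum_right ip_scale_right)
      finally have "ip V r r = ip V r (y m) - (\<Sum>a<q. ip V (u a) (y m) * ip V r (u a))" .
      then have "ip V r r = ip V r (y m)" using ort by simp
      then have "ip V w (y m) = (1 / sqrt (ip V r r)) * ip V r r"
        by (simp only: w_def ip_scale_left)
      then have "(ip V w (y m))\<^sup>2 = ip V r r"
        using pos by (simp add: power_divide power2_eq_square)
      then show ?thesis using rr True by simp
    next
      case False
      then have m': "m' \<in> M" using that by simp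
      \<comment> \<open>The old system already attains equality for \<open>m'\<close>, so Bessel for
        the longer one leaves no room for a nonzero coefficient along \<open>w\<close>.\<close>
      have "(\<Sum>a<Suc q. (ip V ((u(q := w)) a) (y m'))\<^sup>2) \<le> ip V (y m') (y m')"
        by (rule bessel_inequality[OF o])
      moreover have "(\<Sum>a<Suc q. (ip V ((u(q := w)) a) (y m'))\<^sup>2)
          = ip V (y m') (y m') + (ip V w (y m'))\<^sup>2" using qu(3)[OF m'] by simp
      ultimately show ?thesis by (smt (verit) zero_le_power2)
    qed
    then have "\<forall>m'\<in>insert m M. ip V (y m') (y m') = (\<Sum>a<Suc q. (ip V ((u(q := w)) a) (y m'))\<^sup>2)"
      by blast
    moreover have "Suc q \<le> card (insert m M)" using qu(1) insert.hyps by simp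
    ultimately show ?thesis using o by blast
  qed
qed

section \<open>Eigenvectors of a symmetric matrix by maximising the Rayleigh quotient\<close>

lemma continuous_on_coordinate: "continuous_on S (\<lambda>w::'a \<Rightarrow> real. w i)"
  using continuous_on_product_coordinates[of i] by (rule continuous_on_subset) simp

lemma continuous_on_ip:
  assumes "\<And>i. continuous_on S (\<lambda>w. f w i)" "\<And>i. continuous_on S (\<lambda>w. g w i)"
  shows "continuous_on S (\<lambda>w. ip V (f w) (g w))"
  unfolding ip_def by (intro continuous_on_sum continuous_on_mult assms)

text \<open>A closed subset of a product of compact sets, by Tychonoff. \<open>ip V\<close> does not
  see values off \<open>V\<close>; fixing them to 0 keeps these coordinates bounded.\<close>

lemma compact_unit_sphere:
  assumes "finite V"
  shows "compact {w::'a \<Rightarrow> real. (\<forall>i. i \<notin> V \<longrightarrow> w i = 0) \<and> ip V w w = 1 \<and> (\<forall>a<k. ip V w (x a) = 0)}"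
    (is "compact ?K")
proof -
  let ?S = "\<lambda>i. if i \<in> V then {-1..1::real} else {0}"
  have "compactin (product_topology (\<lambda>i. euclidean) (UNIV::'a set)) (PiE UNIV ?S)"
    by (subst compactin_PiE) simp
  then have box: "compact (PiE UNIV ?S)" by (simp add: euclidean_product_topology)
  have sub: "?K = PiE UNIV ?S \<inter> ({w. ip V w w = 1} \<inter> (\<Inter>a\<in>{..<k}. {w. ip V w (x a) = 0}))"
  proof (intro set_eqI iffI)
    fix w assume w: "w \<in> ?K"
    have "\<bar>w i\<bar> \<le> 1" if "i \<in> V" for i
    proof -
      have "w i * w i \<le> ip V w w" unfolding ip_def
        by (rule member_le_sum[OF that]) (use assms in auto)
      then have "(w i)\<^sup>2 \<le> 1" using w by (simp add: power2_eq_square)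
      then show ?thesis by (simp add: abs_square_le_1)
    qed
    then show "w \<in> PiE UNIV ?S \<inter> ({w. ip V w w = 1} \<inter> (\<Inter>a\<in>{..<k}. {w. ip V w (x a) = 0}))"
      using w by (auto simp: abs_le_iff minus_le_iff)
  next
    fix w assume "w \<in> PiE UNIV ?S \<inter> ({w. ip V w w = 1} \<inter> (\<Inter>a\<in>{..<k}. {w. ip V w (x a) = 0}))"
    then show "w \<in> ?K" by (auto simp: PiE_iff split: if_splits) 
  qed
  have "closed {w::'a\<Rightarrow>real. ip V w w = 1}"
    by (intro closed_Collect_eq continuous_on_ip continuous_on_coordinate continuous_on_const)
  moreover have "closed {w::'a\<Rightarrow>real. ip V w (x a) = 0}" for a
    by (intro closed_Collect_eq continuous_on_ip continuous_on_coordinate continuous_on_const)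
  ultimately show ?thesis unfolding sub
    by (intro compact_Int_closed[OF box] closed_Int closed_INT) auto
qed

text \<open>A maximiser \<open>w\<close> of the quadratic form on the unit sphere orthogonal to the
  known eigenvectors is an eigenvector: otherwise moving \<open>w\<close> along its defect
  \<open>B w - \<gamma> w\<close> would increase the Rayleigh quotient.\<close>

lemma exists_eigenvector:
  assumes fin: "finite V" and sym: "\<And>i j. i \<in> V \<Longrightarrow> j \<in> V \<Longrightarrow> B i j = B j i"
    and on: "orthonormal_on V k x" and k: "k < card V"
    and eig: "\<And>a i. a < k \<Longrightarrow> i \<in> V \<Longrightarrow> (\<Sum>j\<in>V. B i j * x a j) = \<beta> a * x a i"
  shows "\<exists>w \<gamma>. ip V w w = 1 \<and> (\<forall>a<k. ip V w (x a) = 0) \<and> (\<forall>i\<in>V. (\<Sum>j\<in>V. B i j * w j) = \<gamma> * w i)"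
proof -
  let ?K = "{w::'a \<Rightarrow> real. (\<forall>i. i \<notin> V \<longrightarrow> w i = 0) \<and> ip V w w = 1 \<and> (\<forall>a<k. ip V w (x a) = 0)}"
  define Bz where "Bz z = (\<lambda>i. \<Sum>j\<in>V. B i j * z j)" for z
  have adj: "ip V (Bz f) g = ip V f (Bz g)" for f g
  proof -
    have "ip V (Bz f) g = (\<Sum>i\<in>V. \<Sum>j\<in>V. B i j * f j * g i)"
      by (simp add: ip_def Bz_def sum_distrib_right)
    also have "\<dots> = (\<Sum>j\<in>V. \<Sum>i\<in>V. B i j * f j * g i)" by (rule sum.swap)
    also have "\<dots> = ip V f (Bz g)"
      unfolding ip_def Bz_def sum_distrib_left by (intro sum.cong) (auto simp: sym)
    finally show ?thesis .
  qed
  have Bz_lin: "ip V (Bz (\<lambda>i. f i + s * g i)) h = ip V (Bz f) h + s * ip V (Bz g) h" for f g h s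
    unfolding adj by (simp add: ip_linear)
  obtain w0 where "ip V w0 w0 = 1" "\<forall>a<k. ip V w0 (x a) = 0"
    using exists_unit_orthogonal[OF fin on k] by blast
  moreover have "ip V (\<lambda>i. if i \<in> V then w0 i else 0) f = ip V w0 f"
    "ip V f (\<lambda>i. if i \<in> V then w0 i else 0) = ip V f w0" for f
    by (auto intro: ip_cong)
  ultimately have "(\<lambda>i. if i \<in> V then w0 i else 0) \<in> ?K" by simp
  then have ne: "?K \<noteq> {}" by (simp only: ex_in_conv[symmetric]) (rule exI)
  have "continuous_on ?K (\<lambda>w. ip V (Bz w) w)"
    unfolding Bz_def
    by (rule continuous_on_ip)
       (intro continuous_on_sum continuous_on_mult[OF continuous_on_const] continuous_on_coordinate)+
  then have "\<exists>w\<in>?K. \<forall>z\<in>?K. ip V (Bz z) z \<le> ip V (Bz w) w"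
    by (rule continuous_attains_sup[OF compact_unit_sphere[OF fin] ne])
  then obtain w where w: "w \<in> ?K" and "\<forall>z\<in>?K. ip V (Bz z) z \<le> ip V (Bz w) w"
    by (elim bexE)
  then have max: "\<And>z. z \<in> ?K \<Longrightarrow> ip V (Bz z) z \<le> ip V (Bz w) w"
    by (elim bspec)
  define \<gamma> where "\<gamma> = ip V (Bz w) w"
  have rayleigh: "ip V (Bz z) z \<le> \<gamma> * ip V z z" if "\<forall>a<k. ip V z (x a) = 0" for z
  proof (cases "ip V z z = 0")
    case True
    then have "ip V (Bz z) z = 0" using ip_self_eq_0[OF fin True] by (simp add: ip_def)
    then show ?thesis using True by simp
  next
    case False
    then have pos: "ip V z z > 0" using ip_self_nonneg[of V z] by linarith
    define c where "c = 1 / sqrt (ip V z z)"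
    define z' where "z' = (\<lambda>i. if i \<in> V then c * z i else 0)"
    have z': "ip V f z' = ip V f (\<lambda>i. c * z i)" "ip V z' f = ip V (\<lambda>i. c * z i) f" for f
      by (auto intro!: ip_cong simp: z'_def)
    have "ip V z' z' = 1" using ip_normalise[OF pos] unfolding z' c_def .
    moreover have "\<forall>a<k. ip V z' (x a) = 0" unfolding z' ip_scale_left using that by simp
    ultimately have "z' \<in> ?K" by (simp add: z'_def)
    then have "ip V (Bz z') z' \<le> \<gamma>" unfolding \<gamma>_def by (rule max)
    also have "ip V (Bz z') z' = c * c * ip V (Bz z) z"
    proof -
      have "ip V (Bz z') z' = c * ip V z' (Bz z)" by (simp only: z'(1) ip_scale_right adj)
      also have "\<dots> = c * (c * ip V (Bz z) z)" by (simp only: z'(2) ip_scale_left adj)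
      finally show ?thesis by simp
    qed
    finally have "(c * c) * ip V (Bz z) z \<le> \<gamma>" .
    moreover have "c * c = 1 / ip V z z" using pos by (simp add: c_def)
    ultimately show ?thesis using pos by (simp add: field_simps)
  qed
  have ww: "ip V w w = 1" and wx: "\<And>a. a < k \<Longrightarrow> ip V w (x a) = 0" using w by auto
  \<comment> \<open>The defect is orthogonal to \<open>w\<close>, and to each \<open>x a\<close>
    because \<open>B\<close> is symmetric and \<open>x a\<close> an eigenvector. Hence every
    \<open>w + s y\<close> is an admissible competitor.\<close>
  define y where "y = (\<lambda>i. Bz w i - \<gamma> * w i)"
  have yw: "ip V y w = 0" by (simp add: y_def ip_linear \<gamma>_def ww)
  have yx: "ip V y (x a) = 0" if "a < k" for a
  proof -
    have "ip V (Bz w) (x a) = ip V w (\<lambda>i. \<beta> a * x a i)"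
      unfolding adj by (rule ip_cong) (simp_all add: Bz_def eig that)
    then show ?thesis using wx that by (simp add: y_def ip_linear)
  qed
  have yy: "ip V (Bz w) y = ip V y y"
    using yw by (simp add: y_def ip_linear ip_commute ww \<gamma>_def)
  have ineq: "2 * s * ip V y y \<le> s\<^sup>2 * (\<gamma> * ip V y y - ip V (Bz y) y)" for s
  proof -
    let ?z = "\<lambda>i. w i + s * y i"
    have "ip V (Bz ?z) ?z \<le> \<gamma> * ip V ?z ?z"
      by (rule rayleigh) (simp add: ip_linear wx yx)
    moreover have "ip V (Bz ?z) ?z = \<gamma> + 2 * s * ip V y y + s\<^sup>2 * ip V (Bz y) y"
      using yy adj[of y w] ip_commute[of V y "Bz w"]
      by (simp add: Bz_lin ip_add_right ip_scale_right \<gamma>_def power2_eq_square algebra_simps)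
    moreover have "ip V ?z ?z = 1 + s\<^sup>2 * ip V y y"
      by (simp add: ip_linear yw ip_commute[of V w y] ww power2_eq_square)
    ultimately show ?thesis by (simp add: algebra_simps)
  qed
  have "ip V y y = 0"
  proof (rule ccontr)
    assume "ip V y y \<noteq> 0"
    then have p: "ip V y y > 0" using ip_self_nonneg[of V y] by linarith
    \<comment> \<open>As \<open>D\<close> exceeds the coefficient of \<open>s\<^sup>2\<close>, this
      choice of \<open>s\<close> reduces \<open>ineq\<close> to
      \<open>2 * ip V y y \<le> ip V y y\<close>; the \<open>+ 1\<close> keeps \<open>D\<close>
      positive.\<close>
    define D where "D = \<bar>\<gamma> * ip V y y - ip V (Bz y) y\<bar> + 1"
    define s where "s = ip V y y / D"
    have D: "D > 0" by (simp add: D_def)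
    then have s: "s > 0" using p by (simp add: s_def)
    have "2 * s * ip V y y \<le> s\<^sup>2 * D"
      using ineq[of s] by (smt (verit) D_def mult_left_mono zero_le_power2)
    then have "2 * ip V y y \<le> s * D" using s by (simp add: power2_eq_square)
    then show False using p D by (simp add: s_def)
  qed
  then have "y i = 0" if "i \<in> V" for i
    using ip_self_eq_0[OF fin _ that] by blast
  then have "\<forall>i\<in>V. (\<Sum>j\<in>V. B i j * w j) = \<gamma> * w i"
    by (simp add: y_def Bz_def)
  then show ?thesis using ww wx by blast
qed

lemma spectral_decomposition:
  assumes fin: "finite V" and sym: "\<And>i j. i \<in> V \<Longrightarrow> j \<in> V \<Longrightarrow> B i j = B j i"
  obtains x \<beta> where "orthonormal_on V (card V) x"
    "\<And>i j. i \<in> V \<Longrightarrow> j \<in> V \<Longrightarrow> B i j = (\<Sum>a<card V. \<beta> a * x a i * x a j)"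
proof -
  have "\<exists>x \<beta>. orthonormal_on V k x \<and> (\<forall>a<k. \<forall>i\<in>V. (\<Sum>j\<in>V. B i j * x a j) = \<beta> a * x a i)"
    if "k \<le> card V" for k using that
  proof (induction k)
    case 0
    show ?case by (simp add: orthonormal_on_def)
  next
    case (Suc k)
    then obtain x \<beta> where x: "orthonormal_on V k x"
      "\<And>a i. a < k \<Longrightarrow> i \<in> V \<Longrightarrow> (\<Sum>j\<in>V. B i j * x a j) = \<beta> a * x a i" by auto
    obtain w \<gamma> where w: "ip V w w = 1" "\<forall>a<k. ip V w (x a) = 0"
      "\<forall>i\<in>V. (\<Sum>j\<in>V. B i j * w j) = \<gamma> * w i"
      using exists_eigenvector[OF fin sym x(1) _ x(2)] Suc.prems by (metis Suc_le_lessD)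
    show ?case
      by (intro exI[of _ "x(k := w)"] exI[of _ "\<beta>(k := \<gamma>)"] conjI orthonormal_on_extend[OF x(1)])
         (use w x in \<open>auto simp: less_Suc_eq\<close>)
  qed
  then obtain x \<beta> where x: "orthonormal_on V (card V) x"
    "\<And>a i. a < card V \<Longrightarrow> i \<in> V \<Longrightarrow> (\<Sum>j\<in>V. B i j * x a j) = \<beta> a * x a i" by blast
  have "B i j = (\<Sum>a<card V. \<beta> a * x a i * x a j)" if "i \<in> V" "j \<in> V" for i j
  proof -
    \<comment> \<open>This is \<open>B = B I\<close> with the identity matrix resolved by
      completeness of the eigenbasis.\<close>
    have "B i j = (\<Sum>k\<in>V. B i k * of_bool (k = j))"
      using that fin by (simp add: of_bool_def if_distrib cong: if_cong)
    also have "\<dots> = (\<Sum>k\<in>V. B i k * (\<Sum>a<card V. x a j * x a k))"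
      using that by (simp add: orthonormal_complete[OF fin x(1)])
    also have "\<dots> = (\<Sum>a<card V. (\<Sum>k\<in>V. B i k * x a k) * x a j)"
      unfolding sum_distrib_left sum_distrib_right by (subst sum.swap) (simp add: mult_ac)
    also have "\<dots> = (\<Sum>a<card V. \<beta> a * x a i * x a j)"
      using x(2) that by simp
    finally show ?thesis .
  qed
  then show thesis using that x(1) by blast
qed

section \<open>Eigenvalue decay from Hadamard squares\<close>

text \<open>The spectral data of \<open>A + \<mu>I\<close> are parameters, and
  \<open>beta_nonneg\<close> says that this matrix is positive semidefinite. Symmetry of
  \<open>A\<close> is implicit in \<open>decomp\<close>.\<close>

locale psd_adjacency =
  fixes V :: "'a set" and A :: "'a \<Rightarrow> 'a \<Rightarrow> real" and \<mu> :: real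
    and x :: "nat \<Rightarrow> 'a \<Rightarrow> real" and \<beta> :: "nat \<Rightarrow> real"
  assumes fin: "finite V" and ne: "V \<noteq> {}"
    and A01: "\<And>i j. i \<in> V \<Longrightarrow> j \<in> V \<Longrightarrow> A i j = 0 \<or> A i j = 1"
    and A_diag: "\<And>i. i \<in> V \<Longrightarrow> A i i = 0"
    and lam: "\<mu> \<ge> 1" "\<mu> ^ 6 \<le> real (card V)"
    and on: "orthonormal_on V (card V) x"
    and decomp: "\<And>i j. i \<in> V \<Longrightarrow> j \<in> V \<Longrightarrow>
      A i j + \<mu> * of_bool (i = j) = (\<Sum>a<card V. \<beta> a * x a i * x a j)"
    and beta_nonneg: "\<And>a. a < card V \<Longrightarrow> 0 \<le> \<beta> a"
begin

text \<open>Eigenvalues are measured against \<open>card V\<close>, the order of the top eigenvalue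
  of a dense graph, so a larger \<open>t\<close> means a lower threshold.\<close>

definition heavy :: "real \<Rightarrow> nat set" where
  "heavy t = {a\<in>{..<card V}. \<beta> a \<ge> real (card V) / t}"

definition heavy_mass :: "real \<Rightarrow> real" where
  "heavy_mass t = (\<Sum>a\<in>heavy t. \<beta> a) / real (card V)"

text \<open>By orthonormality this is the squared Frobenius norm of what remains of
  \<open>A + \<mu>I\<close> after removing its heavy part.\<close>

definition tail :: "real \<Rightarrow> real" where
  "tail t = (\<Sum>a\<in>{..<card V} - heavy t. (\<beta> a)\<^sup>2)"

lemma card_pos: "real (card V) > 0"
  using fin ne by (simp add: card_gt_0_iff)

lemma finite_heavy [simp]: "finite (heavy t)"
  by (simp add: heavy_def)

lemma heavy_subset: "heavy t \<subseteq> {..<card V}"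
  by (auto simp: heavy_def)

lemma ip_basis_self: "a < card V \<Longrightarrow> ip V (x a) (x a) = 1"
  using on by (simp add: orthonormal_on_def)

lemma sum_beta: "(\<Sum>a<card V. \<beta> a) = \<mu> * real (card V)"
proof -
  have "(\<Sum>a<card V. \<beta> a) = (\<Sum>a<card V. \<beta> a * ip V (x a) (x a))"
    by (simp add: ip_basis_self)
  also have "\<dots> = (\<Sum>i\<in>V. \<Sum>a<card V. \<beta> a * x a i * x a i)"
    unfolding ip_def sum_distrib_left by (subst sum.swap) (simp add: mult_ac)
  also have "\<dots> = (\<Sum>i\<in>V. A i i + \<mu> * of_bool (i = i))"
    by (intro sum.cong refl) (simp only: decomp)
  finally show ?thesis using A_diag by simp
qed

lemma heavy_mass_le: "heavy_mass t \<le> \<mu>"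
proof -
  have "(\<Sum>a\<in>heavy t. \<beta> a) \<le> (\<Sum>a<card V. \<beta> a)"
    by (rule sum_mono2) (use heavy_subset beta_nonneg in auto)
  then show ?thesis using card_pos by (simp add: heavy_mass_def sum_beta field_simps)
qed

lemma card_heavy_le:
  assumes "t > 0"
  shows "real (card (heavy t)) \<le> t * heavy_mass t"
proof -
  have "real (card (heavy t)) * (real (card V) / t) \<le> (\<Sum>a\<in>heavy t. \<beta> a)"
    by (rule sum_bounded_below) (simp add: heavy_def)
  then show ?thesis using assms card_pos by (simp add: heavy_mass_def field_simps)
qed

lemma sum_beta_ip_square:
  "(\<Sum>a<card V. \<beta> a * (ip V (x a) z)\<^sup>2) = quad_form V A z + \<mu> * ip V z z"
proof -
  have "(\<Sum>a<card V. \<beta> a * (ip V (x a) z)\<^sup>2)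
      = (\<Sum>a<card V. \<Sum>i\<in>V. \<Sum>j\<in>V. \<beta> a * x a i * x a j * (z i * z j))"
    unfolding ip_def power2_eq_square sum_product
    by (simp add: sum_distrib_left mult_ac)
  also have "\<dots> = (\<Sum>i\<in>V. \<Sum>a<card V. \<Sum>j\<in>V. \<beta> a * x a i * x a j * (z i * z j))"
    by (rule sum.swap)
  also have "\<dots> = (\<Sum>i\<in>V. \<Sum>j\<in>V. (\<Sum>a<card V. \<beta> a * x a i * x a j) * (z i * z j))"
    unfolding sum_distrib_right by (intro sum.cong refl sum.swap)
  also have "\<dots> = (\<Sum>i\<in>V. \<Sum>j\<in>V. (A i j + \<mu> * of_bool (i = j)) * (z i * z j))"
    by (intro sum.cong refl) (simp only: decomp)
  also have "\<dots> = (\<Sum>i\<in>V. (\<Sum>j\<in>V. A i j * z i * z j) + (\<Sum>j\<in>V. if i = j then \<mu> * (z i * z j) else 0))"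
    unfolding sum.distrib[symmetric] by (intro sum.cong refl) (auto simp: algebra_simps)
  also have "\<dots> = quad_form V A z + \<mu> * ip V z z"
    using fin by (simp add: quad_form_def ip_def sum.distrib sum_distrib_left mult_ac)
  finally show ?thesis .
qed

text \<open>Since \<open>A\<close> has entries 0 and 1, the entrywise square of \<open>A + \<mu>I\<close> is \<open>A + \<mu>\<^sup>2I\<close>; by the Schur
  product theorem it dominates the entrywise square of every spectral truncation of \<open>A + \<mu>I\<close>.\<close>

lemma hadamard_square_bound:
  assumes "S \<subseteq> {..<card V}"
  shows "(\<Sum>a\<in>S. \<Sum>b\<in>S. \<beta> a * \<beta> b * (\<Sum>i\<in>V. x a i * x b i * z i)\<^sup>2)
    \<le> quad_form V A z + \<mu>\<^sup>2 * ip V z z"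
proof -
  let ?f = "\<lambda>a b. \<beta> a * \<beta> b * (\<Sum>i\<in>V. x a i * x b i * z i)\<^sup>2"
  let ?g = "\<lambda>a b i j. (\<beta> a * x a i * x a j) * (\<beta> b * x b i * x b j) * (z i * z j)"
  let ?n = "card V"
  have "(\<Sum>a\<in>S. \<Sum>b\<in>S. ?f a b) = (\<Sum>(a, b)\<in>S \<times> S. ?f a b)"
    by (simp add: sum.cartesian_product)
  \<comment> \<open>The Schur product theorem in spectral form: the Hadamard square is a combination
    of rank-one forms with weights \<open>\<beta> a * \<beta> b \<ge> 0\<close>, so enlarging the
    index set can only increase it.\<close>
  also have "\<dots> \<le> (\<Sum>(a, b)\<in>{..<?n} \<times> {..<?n}. ?f a b)"
    by (rule sum_mono2) (use assms beta_nonneg in auto)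
  also have "\<dots> = (\<Sum>a<?n. \<Sum>b<?n. ?f a b)" by (simp add: sum.cartesian_product)
  also have "\<dots> = (\<Sum>a<?n. \<Sum>b<?n. \<Sum>i\<in>V. \<Sum>j\<in>V. ?g a b i j)"
    unfolding power2_eq_square sum_product
    by (simp add: sum_distrib_left mult_ac)
  also have "\<dots> = (\<Sum>a<?n. \<Sum>i\<in>V. \<Sum>b<?n. \<Sum>j\<in>V. ?g a b i j)"
    by (intro sum.cong refl sum.swap)
  also have "\<dots> = (\<Sum>a<?n. \<Sum>i\<in>V. \<Sum>j\<in>V. \<Sum>b<?n. ?g a b i j)"
    by (intro sum.cong refl sum.swap)
  also have "\<dots> = (\<Sum>i\<in>V. \<Sum>a<?n. \<Sum>j\<in>V. \<Sum>b<?n. ?g a b i j)"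
    by (rule sum.swap)
  also have "\<dots> = (\<Sum>i\<in>V. \<Sum>j\<in>V. \<Sum>a<?n. \<Sum>b<?n. ?g a b i j)"
    by (intro sum.cong refl sum.swap)
  also have "\<dots> = (\<Sum>i\<in>V. \<Sum>j\<in>V.
      (\<Sum>a<?n. \<beta> a * x a i * x a j) * (\<Sum>b<?n. \<beta> b * x b i * x b j) * (z i * z j))"
    unfolding sum_product by (simp only: sum_distrib_right)
  also have "\<dots> = (\<Sum>i\<in>V. \<Sum>j\<in>V. (A i j + \<mu> * of_bool (i = j))\<^sup>2 * (z i * z j))"
    by (intro sum.cong refl) (simp only: decomp power2_eq_square)
  also have "\<dots> = (\<Sum>i\<in>V. \<Sum>j\<in>V. A i j * z i * z j + (if i = j then \<mu>\<^sup>2 * (z i * z j) else 0))"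
  proof (intro sum.cong refl)
    fix i j assume "i \<in> V" "j \<in> V"
    then show "(A i j + \<mu> * of_bool (i = j))\<^sup>2 * (z i * z j)
      = A i j * z i * z j + (if i = j then \<mu>\<^sup>2 * (z i * z j) else 0)"
      using A01[of i j] A_diag[of i] by auto
  qed
  also have "\<dots> = quad_form V A z + \<mu>\<^sup>2 * ip V z z"
    using fin by (simp add: quad_form_def ip_def sum.distrib sum_distrib_left mult_ac)
  finally show ?thesis .
qed

text \<open>The left-hand side is the trace of the Hadamard square of the truncation to
  \<open>S\<close>. Its range lies in the span of the entrywise products of eigenvectors, hence of
  \<open>q \<le> (card S)\<^sup>2\<close> orthonormal vectors \<open>u c\<close>, and the trace is
  the sum of the form over them. On each \<open>u c\<close> the form is at most that of
  \<open>A + \<mu>I\<close> plus \<open>\<mu>\<^sup>2\<close>, and eigenvalues below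
  \<open>s\<close> contribute at most \<open>s\<close> per basis vector.\<close>

lemma trace_hadamard_square_bound:
  assumes S: "S \<subseteq> {..<card V}" and s: "s \<ge> 0"
  shows "(\<Sum>i\<in>V. (\<Sum>a\<in>S. \<beta> a * (x a i)\<^sup>2)\<^sup>2)
    \<le> (\<Sum>a\<in>{a\<in>{..<card V}. \<beta> a \<ge> s}. \<beta> a) + (s + \<mu>\<^sup>2) * (real (card S))\<^sup>2"
proof -
  \<comment> \<open>The Hadamard square is the sum of the rank-one matrices of these vectors over
    all pairs in \<open>S \<times> S\<close>.\<close>
  define y where "y = (\<lambda>(a, b) i. sqrt (\<beta> a * \<beta> b) * (x a i * x b i))"
  have finS: "finite S" using S finite_subset by blast
  obtain q u where q: "q \<le> card (S \<times> S)" and u: "orthonormal_on V q u"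
    and y: "\<And>m. m \<in> S \<times> S \<Longrightarrow> ip V (y m) (y m) = (\<Sum>c<q. (ip V (u c) (y m))\<^sup>2)"
    using gram_schmidt[OF fin, of "S \<times> S" y] finS by blast
  have nn: "0 \<le> \<beta> a * \<beta> b" if "a \<in> S" "b \<in> S" for a b
    using that S beta_nonneg by (intro mult_nonneg_nonneg) auto
  have "(\<Sum>i\<in>V. (\<Sum>a\<in>S. \<beta> a * (x a i)\<^sup>2)\<^sup>2)
      = (\<Sum>i\<in>V. \<Sum>a\<in>S. \<Sum>b\<in>S. \<beta> a * (x a i)\<^sup>2 * (\<beta> b * (x b i)\<^sup>2))"
    by (simp only: power2_eq_square[of "sum _ _"] sum_product)
  also have "\<dots> = (\<Sum>a\<in>S. \<Sum>i\<in>V. \<Sum>b\<in>S. \<beta> a * (x a i)\<^sup>2 * (\<beta> b * (x b i)\<^sup>2))"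
    by (rule sum.swap)
  also have "\<dots> = (\<Sum>a\<in>S. \<Sum>b\<in>S. \<Sum>i\<in>V. \<beta> a * (x a i)\<^sup>2 * (\<beta> b * (x b i)\<^sup>2))"
    by (intro sum.cong refl sum.swap)
  also have "\<dots> = (\<Sum>a\<in>S. \<Sum>b\<in>S. ip V (y (a, b)) (y (a, b)))"
  proof (intro sum.cong refl)
    fix a b assume ab: "a \<in> S" "b \<in> S"
    have "\<beta> a * (x a i)\<^sup>2 * (\<beta> b * (x b i)\<^sup>2) = y (a, b) i * y (a, b) i" for i
    proof -
      have "y (a, b) i * y (a, b) i = (sqrt (\<beta> a * \<beta> b))\<^sup>2 * (x a i * x b i)\<^sup>2"
        by (simp add: y_def power2_eq_square)
      then show ?thesis using nn[OF ab] by (simp add: power2_eq_square)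
    qed
    then show "(\<Sum>i\<in>V. \<beta> a * (x a i)\<^sup>2 * (\<beta> b * (x b i)\<^sup>2)) = ip V (y (a, b)) (y (a, b))"
      by (simp add: ip_def)
  qed
  also have "\<dots> = (\<Sum>a\<in>S. \<Sum>b\<in>S. \<Sum>c<q. (ip V (u c) (y (a, b)))\<^sup>2)"
    by (intro sum.cong refl) (simp add: y)
  also have "\<dots> = (\<Sum>a\<in>S. \<Sum>c<q. \<Sum>b\<in>S. (ip V (u c) (y (a, b)))\<^sup>2)"
    by (intro sum.cong refl sum.swap)
  also have "\<dots> = (\<Sum>c<q. \<Sum>a\<in>S. \<Sum>b\<in>S. (ip V (u c) (y (a, b)))\<^sup>2)"
    by (rule sum.swap)
  also have "\<dots> = (\<Sum>c<q. \<Sum>a\<in>S. \<Sum>b\<in>S. \<beta> a * \<beta> b * (\<Sum>i\<in>V. x a i * x b i * u c i)\<^sup>2)"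
  proof (intro sum.cong refl)
    fix a b c assume ab: "a \<in> S" "b \<in> S"
    have "ip V (u c) (y (a, b)) = sqrt (\<beta> a * \<beta> b) * (\<Sum>i\<in>V. x a i * x b i * u c i)"
      unfolding y_def prod.case ip_scale_right by (simp add: ip_def mult_ac)
    then show "(ip V (u c) (y (a, b)))\<^sup>2 = \<beta> a * \<beta> b * (\<Sum>i\<in>V. x a i * x b i * u c i)\<^sup>2"
      using nn[OF ab] by (simp add: power_mult_distrib del: real_sqrt_mult)
  qed
  also have "\<dots> \<le> (\<Sum>c<q. (\<Sum>a<card V. \<beta> a * (ip V (x a) (u c))\<^sup>2) + \<mu>\<^sup>2)"
  proof (intro sum_mono)
    fix c assume "c \<in> {..<q}"
    then have "ip V (u c) (u c) = 1" using u by (simp add: orthonormal_on_def)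
    then show "(\<Sum>a\<in>S. \<Sum>b\<in>S. \<beta> a * \<beta> b * (\<Sum>i\<in>V. x a i * x b i * u c i)\<^sup>2)
        \<le> (\<Sum>a<card V. \<beta> a * (ip V (x a) (u c))\<^sup>2) + \<mu>\<^sup>2"
      using hadamard_square_bound[OF S, of "u c"] lam(1) by (simp add: sum_beta_ip_square)
  qed
  also have "\<dots> = (\<Sum>a<card V. \<Sum>c<q. \<beta> a * (ip V (x a) (u c))\<^sup>2) + real q * \<mu>\<^sup>2"
    by (simp add: sum.distrib) (rule sum.swap)
  \<comment> \<open>Bessel for \<open>u\<close> gives each \<open>x a\<close> total weight at most
    1. An eigenvalue at least \<open>s\<close> is charged in full, a smaller one \<open>s\<close>
    times its weight, and all weights together are at most \<open>q\<close>.\<close>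
  also have "\<dots> \<le> (\<Sum>a<card V. (if \<beta> a \<ge> s then \<beta> a else 0) + s * (\<Sum>c<q. (ip V (x a) (u c))\<^sup>2))
      + real q * \<mu>\<^sup>2"
  proof (intro add_mono sum_mono order_refl)
    fix a assume a: "a \<in> {..<card V}"
    have le1: "(\<Sum>c<q. (ip V (x a) (u c))\<^sup>2) \<le> 1"
      using bessel_inequality[OF u, of "x a"] a by (simp add: ip_basis_self ip_commute[of V "x a" "u _"])
    have ge0: "0 \<le> (\<Sum>c<q. (ip V (x a) (u c))\<^sup>2)" by (simp add: sum_nonneg)
    have "(\<Sum>c<q. \<beta> a * (ip V (x a) (u c))\<^sup>2) = \<beta> a * (\<Sum>c<q. (ip V (x a) (u c))\<^sup>2)"
      by (simp add: sum_distrib_left)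
    also have "\<dots> \<le> (if \<beta> a \<ge> s then \<beta> a else 0) + s * (\<Sum>c<q. (ip V (x a) (u c))\<^sup>2)"
    proof (cases "\<beta> a \<ge> s")
      case True
      have "\<beta> a * (\<Sum>c<q. (ip V (x a) (u c))\<^sup>2) \<le> \<beta> a * 1"
        using le1 beta_nonneg a by (intro mult_left_mono) auto
      moreover have "0 \<le> s * (\<Sum>c<q. (ip V (x a) (u c))\<^sup>2)" using s ge0 by simp
      ultimately show ?thesis using True by simp
    next
      case False
      then show ?thesis using ge0 by (simp add: mult_right_mono)
    qed
    finally show "(\<Sum>c<q. \<beta> a * (ip V (x a) (u c))\<^sup>2)
      \<le> (if \<beta> a \<ge> s then \<beta> a else 0) + s * (\<Sum>c<q. (ip V (x a) (u c))\<^sup>2)" .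
  qed
  also have "\<dots> = (\<Sum>a\<in>{a\<in>{..<card V}. \<beta> a \<ge> s}. \<beta> a)
      + s * (\<Sum>c<q. \<Sum>a<card V. (ip V (x a) (u c))\<^sup>2) + real q * \<mu>\<^sup>2"
  proof -
    have "(\<Sum>a<card V. \<Sum>c<q. (ip V (x a) (u c))\<^sup>2) = (\<Sum>c<q. \<Sum>a<card V. (ip V (x a) (u c))\<^sup>2)"
      by (rule sum.swap)
    then show ?thesis
      using sum.inter_filter[of "{..<card V}" \<beta> "\<lambda>a. s \<le> \<beta> a"]
      by (simp add: sum.distrib sum_distrib_left[symmetric])
  qed
  also have "\<dots> \<le> (\<Sum>a\<in>{a\<in>{..<card V}. \<beta> a \<ge> s}. \<beta> a) + s * real q + real q * \<mu>\<^sup>2"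
  proof -
    have "(\<Sum>c<q. \<Sum>a<card V. (ip V (x a) (u c))\<^sup>2) \<le> (\<Sum>c<q. 1)"
    proof (intro sum_mono)
      fix c assume "c \<in> {..<q}"
      then have "ip V (u c) (u c) = 1" using u by (simp add: orthonormal_on_def)
      then show "(\<Sum>a<card V. (ip V (x a) (u c))\<^sup>2) \<le> 1" using bessel_inequality[OF on, of "u c"] by simp
    qed
    then show ?thesis using s by (simp add: mult_left_mono)
  qed
  also have "\<dots> = (\<Sum>a\<in>{a\<in>{..<card V}. \<beta> a \<ge> s}. \<beta> a) + (s + \<mu>\<^sup>2) * real q"
    by (simp add: algebra_simps)
  also have "\<dots> \<le> (\<Sum>a\<in>{a\<in>{..<card V}. \<beta> a \<ge> s}. \<beta> a) + (s + \<mu>\<^sup>2) * (real (card S))\<^sup>2"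
  proof -
    have "real q \<le> real (card (S \<times> S))" using q by simp
    then have "real q \<le> (real (card S))\<^sup>2" by (simp add: card_cartesian_product power2_eq_square)
    then show ?thesis using s by (intro add_left_mono mult_left_mono) auto
  qed
  finally show ?thesis .
qed

section \<open>Growth of the heavy mass and decay of the spectral tail\<close>

lemma trace_trunc: "S \<subseteq> {..<card V} \<Longrightarrow> (\<Sum>i\<in>V. \<Sum>a\<in>S. \<beta> a * (x a i)\<^sup>2) = (\<Sum>a\<in>S. \<beta> a)"
proof -
  assume S: "S \<subseteq> {..<card V}"
  have "(\<Sum>i\<in>V. \<Sum>a\<in>S. \<beta> a * (x a i)\<^sup>2) = (\<Sum>a\<in>S. \<Sum>i\<in>V. \<beta> a * (x a i)\<^sup>2)" by (rule sum.swap)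
  also have "\<dots> = (\<Sum>a\<in>S. \<beta> a * ip V (x a) (x a))"
    by (simp add: ip_def sum_distrib_left power2_eq_square)
  also have "\<dots> = (\<Sum>a\<in>S. \<beta> a)" using S by (intro sum.cong) (auto simp: ip_basis_self)
  finally show ?thesis .
qed

text \<open>Cauchy-Schwarz on the diagonal bounds the trace of the Hadamard square of the heavy part
  from below by \<open>N * g\<^sup>2\<close>, where \<open>N = card V\<close> and
  \<open>g = heavy_mass t\<close>. In the upper bound the rank is at most \<open>t * g\<close>;
  cutting at level \<open>2 * t\<^sup>2\<close> makes the error from small eigenvalues half of this,
  and the hypothesis makes the \<open>\<mu>\<^sup>2\<close> error at most a quarter.\<close>

lemma heavy_mass_growth:
  assumes t: "t > 0" "4 * \<mu>\<^sup>2 * t\<^sup>2 \<le> real (card V)"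
  shows "(heavy_mass t)\<^sup>2 / 4 \<le> heavy_mass (2 * t\<^sup>2)"
proof -
  let ?N = "real (card V)" and ?g = "heavy_mass t"
  define D where "D = (\<Sum>i\<in>V. (\<Sum>a\<in>heavy t. \<beta> a * (x a i)\<^sup>2)\<^sup>2)"
  have "(?N * ?g)\<^sup>2 = (\<Sum>i\<in>V. \<Sum>a\<in>heavy t. \<beta> a * (x a i)\<^sup>2)\<^sup>2"
    using card_pos by (simp add: trace_trunc[OF heavy_subset] heavy_mass_def)
  also have "\<dots> \<le> D * ?N" unfolding D_def
    using sum_squared_le_sum_of_squares[of "\<lambda>i. \<Sum>a\<in>heavy t. \<beta> a * (x a i)\<^sup>2" V] by (simp add: mult.commute)
  finally have "?N * (?N * ?g\<^sup>2) \<le> ?N * D" by (simp add: power2_eq_square mult_ac)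
  then have 1: "?N * ?g\<^sup>2 \<le> D" using card_pos by simp
  have "D \<le> ?N * heavy_mass (2 * t\<^sup>2) + (?N / (2 * t\<^sup>2) + \<mu>\<^sup>2) * (real (card (heavy t)))\<^sup>2"
    unfolding D_def using trace_hadamard_square_bound[OF heavy_subset, of "?N / (2 * t\<^sup>2)" t] t card_pos
    by (simp add: heavy_mass_def heavy_def)
  also have "(real (card (heavy t)))\<^sup>2 \<le> (t * ?g)\<^sup>2"
    using card_heavy_le[OF t(1)] by (intro power_mono) auto
  finally have 2: "D \<le> ?N * heavy_mass (2 * t\<^sup>2) + (?N / (2 * t\<^sup>2) + \<mu>\<^sup>2) * (t * ?g)\<^sup>2"
    using card_pos by (simp add: mult_left_mono)
  have "(?N / (2 * t\<^sup>2)) * (t * ?g)\<^sup>2 = ?N * ?g\<^sup>2 / 2"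
    using t by (simp add: power_mult_distrib field_simps)
  moreover have "\<mu>\<^sup>2 * (t * ?g)\<^sup>2 \<le> ?N * ?g\<^sup>2 / 4"
    using mult_right_mono[OF t(2), of "?g\<^sup>2"] by (simp add: power_mult_distrib algebra_simps)
  ultimately have "?N * (?g\<^sup>2 / 4) \<le> ?N * heavy_mass (2 * t\<^sup>2)"
    using 1 2 unfolding distrib_right by linarith
  then show ?thesis using card_pos by simp
qed

text \<open>If the bound fails at \<open>t\<close>, then by the growth estimate it fails at
  \<open>2 * t\<^sup>2\<close>: squaring \<open>4 * sqrt (2 * t)\<close> and dividing by 4 gives
  \<open>8 * t\<close>, which is the bound at the new level. Repeating this drives the heavy mass
  above its maximum \<open>\<mu>\<close>.\<close>

lemma heavy_mass_le_sqrt: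
  assumes "t \<ge> 1"
  shows "heavy_mass t \<le> 4 * sqrt (2 * t)"
proof (rule ccontr)
  assume neg: "\<not> ?thesis"
  have step: "heavy_mass (2 * t\<^sup>2) > 4 * sqrt (2 * (2 * t\<^sup>2))" if t: "t \<ge> 1" "heavy_mass t > 4 * sqrt (2 * t)" for t
  proof (cases "4 * \<mu>\<^sup>2 * t\<^sup>2 \<le> real (card V)")
    case True
    have "(4 * sqrt (2 * t))\<^sup>2 < (heavy_mass t)\<^sup>2"
      using t by (intro power_strict_mono) auto
    then have "32 * t < (heavy_mass t)\<^sup>2" using t by (simp add: power_mult_distrib)
    moreover have "sqrt (2 * (2 * t\<^sup>2)) = 2 * t"
      using t by (intro real_sqrt_unique) (auto simp: power2_eq_square)
    ultimately show ?thesis using heavy_mass_growth[OF _ True] t by simp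
  next
    \<comment> \<open>This case is void: a failing bound together with
      \<open>heavy_mass t \<le> \<mu>\<close> forces \<open>32 * t < \<mu>\<^sup>2\<close>, and then
      \<open>\<mu> ^ 6 \<le> card V\<close> gives the growth hypothesis.\<close>
    case False
    have "4 * sqrt (2 * t) < \<mu>" using heavy_mass_le[of t] t by simp
    then have "(4 * sqrt (2 * t))\<^sup>2 < \<mu>\<^sup>2" using t by (intro power_strict_mono) auto
    then have a: "32 * t < \<mu>\<^sup>2" using t by (simp add: power_mult_distrib)
    then have "t\<^sup>2 \<le> (\<mu>\<^sup>2 / 32)\<^sup>2" using t by (intro power_mono) auto
    then have "4 * \<mu>\<^sup>2 * t\<^sup>2 \<le> 4 * \<mu>\<^sup>2 * (\<mu>\<^sup>2 / 32)\<^sup>2" by (intro mult_left_mono) auto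
    also have "\<dots> = \<mu> ^ 6 / 256" by (simp add: power2_eq_square eval_nat_numeral)
    also have "\<dots> \<le> real (card V)" using lam zero_le_power[of \<mu> 6] by linarith
    finally show ?thesis using False by simp
  qed
  have "\<exists>t\<ge>2 ^ j. heavy_mass t > 4 * sqrt (2 * t)" for j
  proof (induction j)
    case 0
    then show ?case using neg assms by (auto intro: exI[of _ t])
  next
    case (Suc j)
    then obtain t where t: "t \<ge> 2 ^ j" "heavy_mass t > 4 * sqrt (2 * t)" by blast
    have "(1::real) \<le> 2 ^ j" by simp
    then have t1: "t \<ge> 1" using t by linarith
    have "2 ^ Suc j \<le> 2 * t\<^sup>2"
      using t(1) t1 mult_mono[of "2 ^ j" t 1 t] by (simp add: power2_eq_square)
    then show ?case using step[OF t1 t(2)] by blast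
  qed
  moreover obtain j where j: "\<mu>\<^sup>2 < 2 ^ j" using real_arch_pow[of 2 "\<mu>\<^sup>2"] by auto
  ultimately obtain t where t: "t \<ge> 2 ^ j" "heavy_mass t > 4 * sqrt (2 * t)" by blast
  have "\<mu> = sqrt (\<mu>\<^sup>2)" using lam by simp
  also have "\<dots> \<le> sqrt (2 * t)" using j t zero_le_power2[of \<mu>] by (intro real_sqrt_le_mono) linarith
  also have "\<dots> \<le> 4 * sqrt (2 * t)" using order_trans[OF zero_le_power2[of \<mu>]] j t by simp
  finally show False using t heavy_mass_le[of t] by simp
qed

text \<open>With \<open>N = card V\<close>, an eigenvalue between \<open>N / (2 * t)\<close> and
  \<open>N / t\<close> has square at most \<open>N / t\<close> times itself, and the mass at level
  \<open>2 * t\<close> is at most \<open>8 * sqrt t * N\<close>.\<close>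

lemma tail_step:
  assumes "t \<ge> 1"
  shows "tail t \<le> tail (2 * t) + 8 * (real (card V))\<^sup>2 / sqrt t"
proof -
  let ?N = "real (card V)" and ?U = "{..<card V}"
  have sub: "heavy t \<subseteq> heavy (2 * t)" unfolding heavy_def using assms card_pos
    by (auto intro: order_trans[rotated] simp: frac_le)
  have "?U - heavy t = (?U - heavy (2 * t)) \<union> (heavy (2 * t) - heavy t)"
    using sub heavy_subset by blast
  then have "tail t = tail (2 * t) + (\<Sum>a\<in>heavy (2 * t) - heavy t. (\<beta> a)\<^sup>2)"
    unfolding tail_def using sum.union_disjoint[of "?U - heavy (2 * t)" "heavy (2 * t) - heavy t" "\<lambda>a. (\<beta> a)\<^sup>2"]
    by (simp add: Diff_triv Int_commute inf_sup_aci Diff_disjoint disjoint_iff)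
  also have "(\<Sum>a\<in>heavy (2 * t) - heavy t. (\<beta> a)\<^sup>2) \<le> (\<Sum>a\<in>heavy (2 * t) - heavy t. (?N / t) * \<beta> a)"
    unfolding power2_eq_square
    by (intro sum_mono mult_right_mono) (use beta_nonneg in \<open>auto simp: heavy_def\<close>)
  also have "\<dots> \<le> (\<Sum>a\<in>heavy (2 * t). (?N / t) * \<beta> a)"
    by (intro sum_mono2) (use beta_nonneg assms in \<open>auto simp: heavy_def\<close>)
  also have "\<dots> = ?N / t * (?N * heavy_mass (2 * t))"
    unfolding sum_distrib_left[symmetric] using card_pos by (simp add: heavy_mass_def)
  also have "\<dots> \<le> ?N / t * (?N * (4 * sqrt (2 * (2 * t))))"
    using assms card_pos by (intro mult_left_mono heavy_mass_le_sqrt) auto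
  also have "\<dots> = 8 * ?N\<^sup>2 / sqrt t"
  proof -
    have r: "sqrt (2 * (2 * t)) = 2 * sqrt t" by (simp add: real_sqrt_mult)
    have "?N / t * (?N * (4 * sqrt (2 * (2 * t)))) = 8 * ?N\<^sup>2 * (sqrt t / t)"
      unfolding r by (simp add: power2_eq_square)
    also have "sqrt t / t = 1 / sqrt t"
      using assms by (simp add: divide_simps)
    finally show ?thesis by simp
  qed
  finally show ?thesis by simp
qed

lemma tail_le:
  assumes "t \<ge> 1"
  shows "tail t \<le> 29 * (real (card V))\<^sup>2 / sqrt t"
proof -
  let ?N = "real (card V)"
  \<comment> \<open>Summing the dyadic pieces: the constant is preserved by the induction because
    \<open>28 / sqrt 2 + 8 \<le> 28\<close>. The last term is the trivial bound on the tail at level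
    \<open>2 ^ J * t\<close>; for large \<open>J\<close> it is at most
    \<open>N\<^sup>2 / sqrt t\<close>, which accounts for 29.\<close>
  have "tail t \<le> 28 * ?N\<^sup>2 / sqrt t + \<mu> * ?N\<^sup>2 / (2 ^ J * t)" if "t \<ge> 1" for J t
    using that
  proof (induction J arbitrary: t)
    case 0
    have "tail t \<le> (\<Sum>a\<in>{..<card V} - heavy t. (?N / t) * \<beta> a)"
      unfolding tail_def power2_eq_square
      by (intro sum_mono mult_right_mono) (use beta_nonneg in \<open>auto simp: heavy_def\<close>)
    also have "\<dots> \<le> (\<Sum>a<card V. (?N / t) * \<beta> a)"
      by (intro sum_mono2) (use beta_nonneg 0 in auto)
    also have "\<dots> = \<mu> * ?N\<^sup>2 / t"
      unfolding sum_distrib_left[symmetric] sum_beta by (simp add: power2_eq_square)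
    finally have "tail t \<le> \<mu> * ?N\<^sup>2 / t" .
    moreover have "0 \<le> 28 * ?N\<^sup>2 / sqrt t" using 0 by simp
    ultimately show ?case by (simp del: zero_le_divide_iff) 
  next
    case (Suc J)
    have "tail t \<le> tail (2 * t) + 8 * ?N\<^sup>2 / sqrt t" by (rule tail_step[OF Suc.prems])
    also have "tail (2 * t) \<le> 28 * ?N\<^sup>2 / sqrt (2 * t) + \<mu> * ?N\<^sup>2 / (2 ^ J * (2 * t))"
      using Suc.prems by (intro Suc.IH) simp
    also have "28 * ?N\<^sup>2 / sqrt (2 * t) \<le> 20 * ?N\<^sup>2 / sqrt t"
    proof -
      have "(7 / 5 :: real) \<le> sqrt 2" by (rule real_le_rsqrt) (simp add: power2_eq_square)
      then have "7 / 5 * sqrt t \<le> sqrt (2 * t)"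
        using Suc.prems by (simp add: real_sqrt_mult mult_right_mono)
      then have "28 * ?N\<^sup>2 / sqrt (2 * t) \<le> 28 * ?N\<^sup>2 / (7 / 5 * sqrt t)"
        using Suc.prems by (intro divide_left_mono) auto
      then show ?thesis by simp
    qed
    finally show ?case by (simp add: mult_ac) 
  qed
  moreover obtain J where J: "\<mu> < 2 ^ J" using real_arch_pow[of 2 \<mu>] by auto
  ultimately have "tail t \<le> 28 * ?N\<^sup>2 / sqrt t + \<mu> * ?N\<^sup>2 / (2 ^ J * t)" using assms by blast
  also have "\<mu> * ?N\<^sup>2 / (2 ^ J * t) \<le> 1 * ?N\<^sup>2 / t"
    using J assms lam by (simp add: divide_simps mult.commute) (intro mult_right_mono, simp_all)
  also have "\<dots> \<le> 1 * ?N\<^sup>2 / sqrt t"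
  proof -
    have "sqrt t \<le> t" using assms by (intro real_le_lsqrt) (auto simp: power2_eq_square)
    then show ?thesis using assms by (intro divide_left_mono) auto
  qed
  finally show ?thesis by simp
qed

end

section \<open>Few cherries\<close>

definition cherries :: "'a set \<Rightarrow> ('a \<Rightarrow> 'a \<Rightarrow> bool) \<Rightarrow> ('a \<times> 'a \<times> 'a) set" where
  "cherries V E = {(i, j, k). i \<in> V \<and> j \<in> V \<and> k \<in> V \<and> E i j \<and> E j k \<and> \<not> E i k \<and> i \<noteq> k}"

context psd_adjacency
begin

definition trunc :: "real \<Rightarrow> 'a \<Rightarrow> 'a \<Rightarrow> real" where
  "trunc t i j = (\<Sum>a\<in>heavy t. \<beta> a * x a i * x a j)"

text \<open>Gram vectors for \<open>trunc\<close>: only the coordinates in \<open>heavy t\<close>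
  are used, so the dimension is bounded in terms of \<open>t\<close> alone.\<close>

definition emb :: "'a \<Rightarrow> nat \<Rightarrow> real" where
  "emb i a = sqrt (\<beta> a) * x a i"

lemma heavy_beta_nonneg: "a \<in> heavy t \<Longrightarrow> 0 \<le> \<beta> a"
  using beta_nonneg heavy_subset by auto

lemma emb_mult: "a \<in> heavy t \<Longrightarrow> emb i a * emb j a = \<beta> a * x a i * x a j"
proof -
  assume "a \<in> heavy t"
  then have "sqrt (\<beta> a) * sqrt (\<beta> a) = \<beta> a" using heavy_beta_nonneg by simp
  then show ?thesis unfolding emb_def by (metis (no_types, lifting) mult.assoc mult.commute)
qed

lemma trunc_eq_emb: "trunc t i j = (\<Sum>a\<in>heavy t. emb i a * emb j a)"
  unfolding trunc_def by (intro sum.cong refl) (simp only: emb_mult)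

lemma trunc_dist:
  "(\<Sum>a\<in>heavy t. (emb i a - emb j a)\<^sup>2) = trunc t i i + trunc t j j - 2 * trunc t i j"
  unfolding trunc_eq_emb sum_distrib_left sum.distrib[symmetric] sum_subtractf[symmetric]
  by (intro sum.cong refl) (simp add: power2_eq_square algebra_simps)

text \<open>Test the domination of the truncation by \<open>A + \<mu>I\<close> on the indicator of
  \<open>Q\<close>. This prevents many Gram vectors of norm above 1 from lying close
  together.\<close>

lemma sum_trunc_le:
  assumes Q: "Q \<subseteq> V"
  shows "(\<Sum>i\<in>Q. \<Sum>j\<in>Q. trunc t i j) \<le> (real (card Q))\<^sup>2 + \<mu> * real (card Q)"
proof -
  have sq: "(\<Sum>i\<in>Q. \<Sum>j\<in>Q. \<Sum>a\<in>S. \<beta> a * x a i * x a j) = (\<Sum>a\<in>S. \<beta> a * (\<Sum>i\<in>Q. x a i)\<^sup>2)" for S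
  proof -
    have "(\<Sum>i\<in>Q. \<Sum>j\<in>Q. \<Sum>a\<in>S. \<beta> a * x a i * x a j) = (\<Sum>i\<in>Q. \<Sum>a\<in>S. \<Sum>j\<in>Q. \<beta> a * x a i * x a j)"
      by (intro sum.cong refl sum.swap)
    also have "\<dots> = (\<Sum>a\<in>S. \<Sum>i\<in>Q. \<Sum>j\<in>Q. \<beta> a * x a i * x a j)" by (rule sum.swap)
    finally show ?thesis
      unfolding power2_eq_square sum_product by (simp add: sum_distrib_left mult_ac)
  qed
  have finQ: "finite Q" using Q fin finite_subset by blast
  have "(\<Sum>i\<in>Q. \<Sum>j\<in>Q. trunc t i j) = (\<Sum>a\<in>heavy t. \<beta> a * (\<Sum>i\<in>Q. x a i)\<^sup>2)"
    unfolding trunc_def by (rule sq)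
  also have "\<dots> \<le> (\<Sum>a<card V. \<beta> a * (\<Sum>i\<in>Q. x a i)\<^sup>2)"
    by (rule sum_mono2) (use heavy_subset beta_nonneg in auto)
  also have "\<dots> = (\<Sum>i\<in>Q. \<Sum>j\<in>Q. \<Sum>a<card V. \<beta> a * x a i * x a j)"
    by (rule sq[symmetric])
  also have "\<dots> = (\<Sum>i\<in>Q. \<Sum>j\<in>Q. A i j + \<mu> * of_bool (i = j))"
    by (intro sum.cong refl) (use Q in \<open>simp only: decomp subsetD\<close>)
  also have "\<dots> \<le> (\<Sum>i\<in>Q. \<Sum>j\<in>Q. 1 + (if i = j then \<mu> else 0))"
  proof (intro sum_mono)
    fix i j assume "i \<in> Q" "j \<in> Q"
    then have "A i j = 0 \<or> A i j = 1" using Q by (intro A01) auto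
    then have "A i j \<le> 1" by auto
    then show "A i j + \<mu> * of_bool (i = j) \<le> 1 + (if i = j then \<mu> else 0)" by auto
  qed
  also have "\<dots> = (real (card Q))\<^sup>2 + \<mu> * real (card Q)"
    using finQ by (simp add: sum.distrib power2_eq_square algebra_simps)
  finally show ?thesis .
qed

lemma trunc_error:
  "(\<Sum>i\<in>V. \<Sum>j\<in>V. (A i j + \<mu> * of_bool (i = j) - trunc t i j)\<^sup>2) = tail t"
proof -
  let ?S = "{..<card V} - heavy t"
  let ?g = "\<lambda>a b i j. (\<beta> a * x a i * x a j) * (\<beta> b * x b i * x b j)"
  have "(\<Sum>i\<in>V. \<Sum>j\<in>V. (A i j + \<mu> * of_bool (i = j) - trunc t i j)\<^sup>2)
      = (\<Sum>i\<in>V. \<Sum>j\<in>V. (\<Sum>a\<in>?S. \<beta> a * x a i * x a j)\<^sup>2)"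
  proof (intro sum.cong refl)
    fix i j assume "i \<in> V" "j \<in> V"
    then have "A i j + \<mu> * of_bool (i = j) - trunc t i j = (\<Sum>a\<in>?S. \<beta> a * x a i * x a j)"
      unfolding decomp[OF \<open>i \<in> V\<close> \<open>j \<in> V\<close>] trunc_def
      by (subst sum_diff) (use heavy_subset in auto)
    then show "(A i j + \<mu> * of_bool (i = j) - trunc t i j)\<^sup>2 = (\<Sum>a\<in>?S. \<beta> a * x a i * x a j)\<^sup>2"
      by simp
  qed
  also have "\<dots> = (\<Sum>i\<in>V. \<Sum>j\<in>V. \<Sum>a\<in>?S. \<Sum>b\<in>?S. ?g a b i j)"
    by (simp only: power2_eq_square sum_product)
  also have "\<dots> = (\<Sum>i\<in>V. \<Sum>a\<in>?S. \<Sum>j\<in>V. \<Sum>b\<in>?S. ?g a b i j)"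
    by (intro sum.cong refl sum.swap)
  also have "\<dots> = (\<Sum>i\<in>V. \<Sum>a\<in>?S. \<Sum>b\<in>?S. \<Sum>j\<in>V. ?g a b i j)"
    by (intro sum.cong refl sum.swap)
  also have "\<dots> = (\<Sum>a\<in>?S. \<Sum>i\<in>V. \<Sum>b\<in>?S. \<Sum>j\<in>V. ?g a b i j)"
    by (rule sum.swap)
  also have "\<dots> = (\<Sum>a\<in>?S. \<Sum>b\<in>?S. \<Sum>i\<in>V. \<Sum>j\<in>V. ?g a b i j)"
    by (intro sum.cong refl sum.swap)
  also have "\<dots> = (\<Sum>a\<in>?S. \<Sum>b\<in>?S. \<beta> a * \<beta> b * (ip V (x a) (x b))\<^sup>2)"
    unfolding ip_def power2_eq_square sum_product by (simp add: sum_distrib_left mult_ac)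
  also have "\<dots> = (\<Sum>a\<in>?S. \<Sum>b\<in>?S. if a = b then \<beta> a * \<beta> b else 0)"
    using on by (intro sum.cong refl) (auto simp: orthonormal_on_def)
  also have "\<dots> = tail t"
    by (simp add: tail_def power2_eq_square)
  finally show ?thesis .
qed

lemma trunc_diag_nonneg: "0 \<le> trunc t i i"
  by (simp add: trunc_eq_emb sum_nonneg)

lemma card_large_diag:
  assumes K: "K > 0" and t: "t \<ge> 1"
  shows "real (card {i\<in>V. trunc t i i > K}) \<le> 4 * sqrt (2 * t) * real (card V) / K"
proof -
  have "real (card {i\<in>V. trunc t i i > K}) * K \<le> (\<Sum>i\<in>{i\<in>V. trunc t i i > K}. trunc t i i)"
    by (rule sum_bounded_below) simp
  also have "\<dots> \<le> (\<Sum>i\<in>V. trunc t i i)"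
    using fin by (intro sum_mono2) (auto simp: trunc_diag_nonneg)
  also have "\<dots> = heavy_mass t * real (card V)"
    using trace_trunc[OF heavy_subset, of t] card_pos
    by (simp add: trunc_def heavy_mass_def power2_eq_square mult.assoc)
  also have "\<dots> \<le> 4 * sqrt (2 * t) * real (card V)"
    using heavy_mass_le_sqrt[OF t] by (intro mult_right_mono) auto
  finally show ?thesis using K by (simp add: field_simps)
qed

text \<open>Pigeonhole on a grid of side \<open>h\<close> in the space of Gram vectors, with
  \<open>2 * m + 1\<close> cells per coordinate. Vectors in one cell are at squared distance at most
  \<open>\<theta>\<close>, so their inner products are at least \<open>1 + \<theta> / 2\<close>, and
  comparison with \<open>sum_trunc_le\<close> leaves at most \<open>2 * \<mu> / \<theta>\<close> of
  them.\<close>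

lemma card_medium_diag:
  assumes K: "K > 0" and h: "h > 0" and \<theta>: "\<theta> > 0" and hr: "real (card (heavy t)) * h\<^sup>2 \<le> \<theta>"
  defines "m \<equiv> \<lceil>sqrt K / h\<rceil> + 1"
  shows "real (card {i\<in>V. 1 + \<theta> < trunc t i i \<and> trunc t i i \<le> K})
    \<le> real (nat (2 * m + 1) ^ card (heavy t)) * (2 * \<mu> / \<theta>)"
proof -
  define W where "W = {i\<in>V. 1 + \<theta> < trunc t i i \<and> trunc t i i \<le> K}"
  define cell where "cell i = restrict (\<lambda>a. \<lfloor>emb i a / h\<rfloor>) (heavy t)" for i
  define P where "P = (\<Pi>\<^sub>E a\<in>heavy t. {-m..m})"
  have finW: "finite W" using fin by (simp add: W_def)
  have finP: "finite P" by (simp add: P_def finite_PiE)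
  have cardP: "card P = nat (2 * m + 1) ^ card (heavy t)"
    by (simp add: P_def card_PiE algebra_simps)
  have cell_P: "cell i \<in> P" if "i \<in> W" for i
  proof -
    have "-m \<le> \<lfloor>emb i a / h\<rfloor> \<and> \<lfloor>emb i a / h\<rfloor> \<le> m" if a: "a \<in> heavy t" for a
    proof -
      have "emb i a * emb i a \<le> trunc t i i"
        unfolding trunc_eq_emb by (rule member_le_sum[OF a]) auto
      also have "\<dots> \<le> K" using \<open>i \<in> W\<close> by (simp add: W_def)
      finally have "(emb i a)\<^sup>2 \<le> K" by (simp add: power2_eq_square)
      then have "\<bar>emb i a\<bar> \<le> sqrt K" by (metis real_sqrt_abs real_sqrt_le_iff)
      then have "\<bar>emb i a / h\<bar> \<le> sqrt K / h" using h by (simp add: abs_divide divide_right_mono)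
      then show ?thesis unfolding m_def by linarith
    qed
    then show ?thesis by (auto simp: P_def cell_def)
  qed
  have small: "real (card {i\<in>W. cell i = c}) \<le> 2 * \<mu> / \<theta>" for c
  proof -
    define Q where "Q = {i\<in>W. cell i = c}"
    have QV: "Q \<subseteq> V" by (auto simp: Q_def W_def)
    have "1 + \<theta> / 2 \<le> trunc t i j" if ij: "i \<in> Q" "j \<in> Q" for i j
    proof -
      have "(\<Sum>a\<in>heavy t. (emb i a - emb j a)\<^sup>2) \<le> (\<Sum>a\<in>heavy t. h\<^sup>2)"
      proof (intro sum_mono)
        fix a assume a: "a \<in> heavy t"
        have "cell i = cell j" using ij by (simp add: Q_def)
        then have "cell i a = cell j a" by simp
        then have "\<lfloor>emb i a / h\<rfloor> = \<lfloor>emb j a / h\<rfloor>" using a by (simp add: cell_def)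
        then have "\<bar>emb i a / h - emb j a / h\<bar> \<le> 1" by linarith
        then have "\<bar>emb i a - emb j a\<bar> \<le> h" using h
          by (simp add: diff_divide_distrib[symmetric] abs_divide)
        then show "(emb i a - emb j a)\<^sup>2 \<le> h\<^sup>2" using h by (simp add: abs_le_square_iff[symmetric])
      qed
      then have "trunc t i i + trunc t j j - 2 * trunc t i j \<le> \<theta>" unfolding trunc_dist using hr by simp
      moreover have "trunc t i i > 1 + \<theta>" "trunc t j j > 1 + \<theta>" using ij by (auto simp: Q_def W_def)
      ultimately show ?thesis by argo
    qed
    then have "(\<Sum>i\<in>Q. \<Sum>j\<in>Q. 1 + \<theta> / 2) \<le> (\<Sum>i\<in>Q. \<Sum>j\<in>Q. trunc t i j)"
      by (intro sum_mono) auto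
    also have "\<dots> \<le> (real (card Q))\<^sup>2 + \<mu> * real (card Q)" by (rule sum_trunc_le[OF QV])
    finally have "real (card Q) * (real (card Q) * \<theta>) \<le> real (card Q) * (2 * \<mu>)"
      by (simp add: power2_eq_square algebra_simps)
    then have "real (card Q) * \<theta> \<le> 2 * \<mu>" using lam
      by (cases "card Q = 0") auto
    then show ?thesis using \<theta> by (simp add: Q_def field_simps)
  qed
  have "W = (\<Union>c\<in>P. {i\<in>W. cell i = c})" using cell_P by auto
  then have "card W \<le> (\<Sum>c\<in>P. card {i\<in>W. cell i = c})" using card_UN_le[OF finP] by metis
  then have "real (card W) \<le> (\<Sum>c\<in>P. real (card {i\<in>W. cell i = c}))"
    by (metis of_nat_mono of_nat_sum)
  also have "\<dots> \<le> real (card P) * (2 * \<mu> / \<theta>)"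
    by (rule sum_bounded_above) (rule small)
  finally show ?thesis unfolding cardP W_def .
qed

text \<open>Chebyshev's inequality for the Frobenius error; off the diagonal the term with
  \<open>\<mu>\<close> vanishes.\<close>

lemma card_bad_pairs:
  assumes "t \<ge> 1" "\<kappa> > 0"
  shows "real (card {(i, j). i \<in> V \<and> j \<in> V \<and> i \<noteq> j \<and> \<bar>A i j - trunc t i j\<bar> > \<kappa>})
    \<le> 29 * (real (card V))\<^sup>2 / sqrt t / \<kappa>\<^sup>2"
proof -
  let ?P = "{(i, j). i \<in> V \<and> j \<in> V \<and> i \<noteq> j \<and> \<bar>A i j - trunc t i j\<bar> > \<kappa>}"
  let ?f = "\<lambda>(i, j). (A i j + \<mu> * of_bool (i = j) - trunc t i j)\<^sup>2"
  have sub: "?P \<subseteq> V \<times> V" by auto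
  have "real (card ?P) * \<kappa>\<^sup>2 \<le> sum ?f ?P"
  proof (rule sum_bounded_below)
    fix p assume "p \<in> ?P"
    then obtain i j where p: "p = (i, j)" "i \<noteq> j" "\<bar>A i j - trunc t i j\<bar> > \<kappa>" by auto
    then have "\<bar>\<kappa>\<bar> \<le> \<bar>A i j - trunc t i j\<bar>" using assms by simp
    then show "\<kappa>\<^sup>2 \<le> ?f p" using p by (simp add: abs_le_square_iff)
  qed
  also have "\<dots> \<le> sum ?f (V \<times> V)"
    using fin sub by (intro sum_mono2) auto
  also have "\<dots> = tail t" unfolding trunc_error[symmetric] by (simp add: sum.cartesian_product)
  also have "\<dots> \<le> 29 * (real (card V))\<^sup>2 / sqrt t" by (rule tail_le[OF assms(1)])
  finally show ?thesis using assms by (simp add: field_simps)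
qed

text \<open>No cherry has all three Gram vectors of squared norm at most \<open>1 + 1/100\<close>
  and all three entries approximated within \<open>1/100\<close>: adjacency puts \<open>i\<close>
  near \<open>j\<close> and \<open>j\<close> near \<open>k\<close>, hence \<open>i\<close> near
  \<open>k\<close>, while the inner product of \<open>i\<close> and \<open>k\<close> is near 0. So
  every cherry contains an exceptional vertex or pair, in one of three positions each. The constants
  \<open>200\<close> and \<open>290000\<close> are \<open>2 / \<theta>\<close> and
  \<open>29 / \<kappa>\<^sup>2\<close> at \<open>1/100\<close>.\<close>

lemma card_cherries_le:
  assumes t: "t \<ge> 1" and K: "K > 0"
    and h: "h > 0" "real (card (heavy t)) * h\<^sup>2 \<le> 1 / 100"
  shows "real (card (cherries V (\<lambda>i j. A i j = 1))) \<le>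
    3 * (real (card V))\<^sup>2 * (4 * sqrt (2 * t) * real (card V) / K
       + real (nat (2 * (\<lceil>sqrt K / h\<rceil> + 1) + 1) ^ card (heavy t)) * (200 * \<mu>))
    + 3 * real (card V) * (290000 * (real (card V))\<^sup>2 / sqrt t)"
proof -
  define C where "C = trunc t"
  define P where "P = {(i, j). i \<in> V \<and> j \<in> V \<and> i \<noteq> j \<and> \<bar>A i j - C i j\<bar> > 1/100}"
  define W where "W = {i\<in>V. C i i > 1 + 1/100}"
  let ?N = "real (card V)"
  have finP: "finite P"
    by (rule finite_subset[of _ "V \<times> V"]) (use fin in \<open>auto simp: P_def\<close>)
  have finW: "finite W" using fin by (simp add: W_def)
  have key: "(i, j, k) \<in> W \<times> V \<times> V \<union> V \<times> W \<times> V \<union> V \<times> V \<times> W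
      \<union> (\<lambda>((i, j), k). (i, j, k)) ` (P \<times> V) \<union> (\<lambda>((j, k), i). (i, j, k)) ` (P \<times> V)
      \<union> (\<lambda>((i, k), j). (i, j, k)) ` (P \<times> V)"
    if ch: "(i, j, k) \<in> cherries V (\<lambda>i j. A i j = 1)" for i j k
  proof (rule ccontr)
    assume neg: "\<not> ?thesis"
    have V: "i \<in> V" "j \<in> V" "k \<in> V" and e: "A i j = 1" "A j k = 1" "A i k = 0"
      and d: "i \<noteq> k" "i \<noteq> j" "j \<noteq> k"
      using ch A01[of i k] A_diag by (auto simp: cherries_def)
    have w: "C i i \<le> 1 + 1/100" "C j j \<le> 1 + 1/100" "C k k \<le> 1 + 1/100"
      using neg V by (auto simp: W_def)
    have "(i, j) \<notin> P" "(j, k) \<notin> P" "(i, k) \<notin> P" using neg V by force+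
    then have "\<bar>1 - C i j\<bar> \<le> 1/100" "\<bar>1 - C j k\<bar> \<le> 1/100" "\<bar>0 - C i k\<bar> \<le> 1/100"
      using V e d by (auto simp: P_def)
    then have p: "C i j \<ge> 1 - 1/100" "C j k \<ge> 1 - 1/100" "C i k \<le> 1/100"
      by linarith+
    have tri: "C i i + C k k - 2 * C i k \<le> 2 * (C i i + C j j - 2 * C i j) + 2 * (C j j + C k k - 2 * C j k)"
    proof -
      have "(\<Sum>a\<in>heavy t. (emb i a - emb k a)\<^sup>2)
        \<le> (\<Sum>a\<in>heavy t. 2 * (emb i a - emb j a)\<^sup>2 + 2 * (emb j a - emb k a)\<^sup>2)"
      proof (intro sum_mono)
        fix a
        have "0 \<le> ((emb i a - emb j a) - (emb j a - emb k a))\<^sup>2" by simp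
        then show "(emb i a - emb k a)\<^sup>2 \<le> 2 * (emb i a - emb j a)\<^sup>2 + 2 * (emb j a - emb k a)\<^sup>2"
          by (simp add: power2_eq_square algebra_simps)
      qed
      then show ?thesis
        by (simp only: sum.distrib sum_distrib_left[symmetric] trunc_dist C_def)
    qed
    \<comment> \<open>Nonnegativity gives \<open>C i i\<close> and \<open>C k k\<close> at least
      \<open>0.97\<close>, so \<open>i\<close> and \<open>k\<close> have squared distance at least
      \<open>1.92\<close>, whereas \<open>tri\<close> bounds it by \<open>0.16\<close>.\<close>
    have "0 \<le> C i i + C j j - 2 * C i j" "0 \<le> C j j + C k k - 2 * C j k"
      unfolding C_def trunc_dist[symmetric] by (simp_all add: sum_nonneg)
    then show False using tri w p by argo
  qed
  let ?T = "W \<times> V \<times> V \<union> V \<times> W \<times> V \<union> V \<times> V \<times> W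
      \<union> (\<lambda>((i, j), k). (i, j, k)) ` (P \<times> V) \<union> (\<lambda>((j, k), i). (i, j, k)) ` (P \<times> V)
      \<union> (\<lambda>((i, k), j). (i, j, k)) ` (P \<times> V)"
  have im: "card (f ` (P \<times> V)) \<le> card P * card V" for f :: "('a \<times> 'a) \<times> 'a \<Rightarrow> 'a \<times> 'a \<times> 'a"
    using card_image_le[of "P \<times> V" f] fin finP by (simp add: card_cartesian_product)
  have "card (cherries V (\<lambda>i j. A i j = 1)) \<le> card ?T"
    by (rule card_mono) (use fin finP finW key in \<open>auto intro!: finite_imageI\<close>)
  also have "\<dots> \<le> card (W \<times> V \<times> V) + card (V \<times> W \<times> V) + card (V \<times> V \<times> W)
      + card ((\<lambda>((i, j), k). (i, j, k)) ` (P \<times> V)) + card ((\<lambda>((j, k), i). (i, j, k)) ` (P \<times> V))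
      + card ((\<lambda>((i, k), j). (i, j, k)) ` (P \<times> V))"
    by (meson add_mono card_Un_le le_refl order_trans)
  also have "\<dots> \<le> card W * (card V * card V) + card V * (card W * card V) + card V * (card V * card W)
      + card P * card V + card P * card V + card P * card V"
    by (intro add_mono im) (simp_all add: card_cartesian_product)
  also have "\<dots> = 3 * (card V)\<^sup>2 * card W + 3 * card V * card P"
    by (simp add: power2_eq_square)
  finally have "real (card (cherries V (\<lambda>i j. A i j = 1))) \<le> real (3 * (card V)\<^sup>2 * card W + 3 * card V * card P)"
    by (rule of_nat_mono)
  then have 1: "real (card (cherries V (\<lambda>i j. A i j = 1))) \<le> 3 * ?N\<^sup>2 * real (card W) + 3 * ?N * real (card P)"
    by simp
  have "W \<subseteq> {i\<in>V. trunc t i i > K} \<union> {i\<in>V. 1 + 1/100 < trunc t i i \<and> trunc t i i \<le> K}"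
    by (auto simp: W_def C_def)
  then have "card W \<le> card ({i\<in>V. trunc t i i > K} \<union> {i\<in>V. 1 + 1/100 < trunc t i i \<and> trunc t i i \<le> K})"
    using fin by (intro card_mono) auto
  also have "\<dots> \<le> card {i\<in>V. trunc t i i > K} + card {i\<in>V. 1 + 1/100 < trunc t i i \<and> trunc t i i \<le> K}"
    by (rule card_Un_le)
  finally have "real (card W) \<le> real (card {i\<in>V. trunc t i i > K})
      + real (card {i\<in>V. 1 + 1/100 < trunc t i i \<and> trunc t i i \<le> K})" by linarith
  also have "\<dots> \<le> 4 * sqrt (2 * t) * ?N / K
       + real (nat (2 * (\<lceil>sqrt K / h\<rceil> + 1) + 1) ^ card (heavy t)) * (200 * \<mu>)"
    using card_large_diag[OF K t] card_medium_diag[OF K h(1) _ h(2)] by simp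
  finally have 2: "real (card W) \<le> 4 * sqrt (2 * t) * ?N / K
       + real (nat (2 * (\<lceil>sqrt K / h\<rceil> + 1) + 1) ^ card (heavy t)) * (200 * \<mu>)" .
  have 3: "real (card P) \<le> 290000 * ?N\<^sup>2 / sqrt t"
    using card_bad_pairs[OF t, of "1/100"] by (simp add: P_def C_def power2_eq_square)
  show ?thesis
    by (rule order_trans[OF 1]) (intro add_mono mult_left_mono 2 3, auto)
qed

end

text \<open>Three error terms are each brought below a third of the target: \<open>t\<close>
  controls the badly approximated pairs, then \<open>K\<close> the very long Gram vectors, and
  finally \<open>card V\<close> must be large against the vectors of medium length, of which there
  are at most \<open>M * 200 * \<mu>\<close> with \<open>M\<close> depending on
  \<open>\<delta>\<close> alone.\<close>

lemma few_cherries_if_small_negative_eigenvalues: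
  fixes \<delta> :: real
  assumes \<delta>: "\<delta> > 0"
  shows "\<exists>N\<^sub>0::nat. \<forall>(V::'a set) E \<mu>. finite V \<and> card V \<ge> N\<^sub>0 \<and>
    (\<forall>i\<in>V. \<forall>j\<in>V. E i j = E j i) \<and> (\<forall>i\<in>V. \<not> E i i) \<and> \<mu> \<ge> 1 \<and> \<mu> ^ 6 \<le> real (card V) \<and>
    (\<forall>z. quad_form V (\<lambda>i j. of_bool (E i j)) z \<ge> - \<mu> * ip V z z)
    \<longrightarrow> real (card (cherries V E)) \<le> \<delta> * real (card V) ^ 3"
proof -
  define t where "t = (3 * 870000 / \<delta>)\<^sup>2 + 1"
  have t: "t \<ge> 1" by (simp add: t_def)
  have st: "870000 / sqrt t \<le> \<delta> / 3"
  proof -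
    have "3 * 870000 / \<delta> \<le> sqrt t" unfolding t_def by (rule real_le_rsqrt) simp
    then show ?thesis using \<delta> t by (simp add: field_simps)
  qed
  define K where "K = 36 * sqrt (2 * t) / \<delta>"
  have K: "K > 0" using t \<delta> by (simp add: K_def)
  \<comment> \<open>\<open>R\<close> bounds the rank \<open>card (heavy t)\<close> independently of
    the graph, and \<open>h\<close> is small enough for the grid argument with
    \<open>\<theta> = 1/100\<close>.\<close>
  define R where "R = t * (4 * sqrt (2 * t))"
  have R: "R \<ge> 0" using t by (simp add: R_def)
  define h where "h = sqrt (1 / (100 * (R + 1)))"
  have h: "h > 0" "h\<^sup>2 = 1 / (100 * (R + 1))" using R by (simp_all add: h_def)
  define M where "M = real (nat (2 * (\<lceil>sqrt K / h\<rceil> + 1) + 1) ^ nat \<lceil>R\<rceil>)"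
  have base: "1 \<le> nat (2 * (\<lceil>sqrt K / h\<rceil> + 1) + 1)"
  proof -
    have "0 \<le> sqrt K / h" using K h by simp
    then have "0 \<le> \<lceil>sqrt K / h\<rceil>" by linarith
    moreover have "0 \<le> m \<Longrightarrow> 1 \<le> nat (2 * (m + 1) + 1)" for m :: int by (simp add: Suc_le_eq)
    ultimately show ?thesis by blast
  qed
  \<comment> \<open>From \<open>card V \<ge> D\<^sup>2\<close> and
    \<open>card V \<ge> \<mu>\<^sup>2\<close> one gets \<open>D * \<mu> \<le> card V\<close>, and
    \<open>1800 = 3 * 3 * 200\<close> turns this into a third of the target.\<close>
  define D where "D = 1800 * M / \<delta>"
  have D: "D \<ge> 0" using \<delta> by (simp add: D_def M_def)
  show ?thesis
  proof (intro exI[of _ "nat \<lceil>D\<^sup>2\<rceil> + 1"] allI impI, elim conjE)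
    fix V :: "'a set" and E \<mu>
    assume fin: "finite V" and big: "nat \<lceil>D\<^sup>2\<rceil> + 1 \<le> card V"
      and sym: "\<forall>i\<in>V. \<forall>j\<in>V. E i j = E j i" and irr: "\<forall>i\<in>V. \<not> E i i"
      and lam: "\<mu> \<ge> 1" "\<mu> ^ 6 \<le> real (card V)"
      and psd: "\<forall>z. quad_form V (\<lambda>i j. of_bool (E i j)) z \<ge> - \<mu> * ip V z z"
    define A where "A i j = (of_bool (E i j) :: real)" for i j
    define B where "B i j = A i j + \<mu> * of_bool (i = j)" for i j
    have Bsym: "B i j = B j i" if "i \<in> V" "j \<in> V" for i j
      using sym that by (auto simp: B_def A_def eq_commute)
    obtain x \<beta> where on: "orthonormal_on V (card V) x"
      and dec: "\<And>i j. i \<in> V \<Longrightarrow> j \<in> V \<Longrightarrow> B i j = (\<Sum>a<card V. \<beta> a * x a i * x a j)"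
      by (rule spectral_decomposition[where V = V and B = B, OF fin Bsym]) (assumption | rule that)+
    have nonneg: "0 \<le> \<beta> a" if a: "a < card V" for a
    proof -
      have "\<beta> a = (\<Sum>b<card V. \<beta> b * (ip V (x b) (x a))\<^sup>2)"
        using sum_orthonormal[OF on a, of "\<lambda>b. \<beta> b * ip V (x b) (x a)"] on a
        by (simp add: power2_eq_square mult.assoc orthonormal_on_def)
      also have "\<dots> = (\<Sum>b<card V. \<Sum>i\<in>V. \<Sum>j\<in>V. \<beta> b * x b i * x b j * (x a i * x a j))"
        unfolding ip_def power2_eq_square sum_product by (simp add: sum_distrib_left mult_ac)
      also have "\<dots> = (\<Sum>i\<in>V. \<Sum>b<card V. \<Sum>j\<in>V. \<beta> b * x b i * x b j * (x a i * x a j))"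
        by (rule sum.swap)
      also have "\<dots> = (\<Sum>i\<in>V. \<Sum>j\<in>V. \<Sum>b<card V. \<beta> b * x b i * x b j * (x a i * x a j))"
        by (intro sum.cong refl sum.swap)
      also have "\<dots> = (\<Sum>i\<in>V. \<Sum>j\<in>V. B i j * (x a i * x a j))"
        by (intro sum.cong refl) (simp add: dec sum_distrib_right)
      also have "\<dots> = (\<Sum>i\<in>V. \<Sum>j\<in>V. A i j * x a i * x a j + (if i = j then \<mu> * (x a i * x a j) else 0))"
        by (intro sum.cong refl) (auto simp: B_def algebra_simps)
      also have "\<dots> = quad_form V A (x a) + \<mu> * ip V (x a) (x a)"
        using fin by (simp add: quad_form_def ip_def sum.distrib sum_distrib_left mult_ac)
      also have "\<dots> \<ge> 0" using psd[rule_format, of "x a"] by (simp add: A_def[abs_def])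
      finally show ?thesis .
    qed
    have ne: "V \<noteq> {}" using big by auto
    interpret psd_adjacency V A \<mu> x \<beta>
      by unfold_locales (use fin ne lam on nonneg dec irr in \<open>auto simp: A_def B_def\<close>)
    let ?N = "real (card V)"
    have r: "real (card (heavy t)) \<le> R"
      unfolding R_def using t
      by (intro order_trans[OF card_heavy_le mult_left_mono[OF heavy_mass_le_sqrt]]) auto
    then have hr: "real (card (heavy t)) * h\<^sup>2 \<le> 1 / 100"
      unfolding h(2) using R by (simp add: field_simps)
    have "card (heavy t) \<le> nat \<lceil>R\<rceil>" using r by linarith
    then have Mle: "real (nat (2 * (\<lceil>sqrt K / h\<rceil> + 1) + 1) ^ card (heavy t)) \<le> M"
      unfolding M_def using base by (intro of_nat_mono power_increasing)
    have N1: "D\<^sup>2 \<le> ?N" using big by linarith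
    have mu2: "\<mu>\<^sup>2 \<le> ?N" using lam power_increasing[of 2 6 \<mu>] by linarith
    have "D * \<mu> \<le> ?N"
    proof -
      have "(D * \<mu>)\<^sup>2 \<le> ?N\<^sup>2"
        unfolding power_mult_distrib power2_eq_square[of ?N] by (intro mult_mono N1 mu2) auto
      then show ?thesis by (rule power2_le_imp_le) simp
    qed
    then have mu: "3 * (M * (200 * \<mu>)) \<le> \<delta> / 3 * ?N"
      using \<delta> by (simp add: D_def field_simps)
    have Kt: "3 * (4 * sqrt (2 * t) * ?N / K) = \<delta> / 3 * ?N"
      using t \<delta> by (simp add: K_def field_simps)
    have Eq: "cherries V (\<lambda>i j. A i j = 1) = cherries V E"
      by (simp add: A_def cherries_def)
    have "real (card (cherries V E)) \<le>
      3 * ?N\<^sup>2 * (4 * sqrt (2 * t) * ?N / K + real (nat (2 * (\<lceil>sqrt K / h\<rceil> + 1) + 1) ^ card (heavy t)) * (200 * \<mu>))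
      + 3 * ?N * (290000 * ?N\<^sup>2 / sqrt t)"
      using card_cherries_le[OF t K h(1) hr] unfolding Eq .
    also have "\<dots> \<le> 3 * ?N\<^sup>2 * (4 * sqrt (2 * t) * ?N / K + M * (200 * \<mu>)) + 3 * ?N * (290000 * ?N\<^sup>2 / sqrt t)"
      using Mle lam by (intro add_mono mult_left_mono mult_right_mono order_refl) auto
    also have "\<dots> = ?N\<^sup>2 * (3 * (4 * sqrt (2 * t) * ?N / K)) + ?N\<^sup>2 * (3 * (M * (200 * \<mu>))) + ?N ^ 3 * (870000 / sqrt t)"
      by (simp add: algebra_simps power2_eq_square power3_eq_cube)
    also have "\<dots> \<le> ?N\<^sup>2 * (\<delta> / 3 * ?N) + ?N\<^sup>2 * (\<delta> / 3 * ?N) + ?N ^ 3 * (\<delta> / 3)"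
      unfolding Kt by (intro add_mono mult_left_mono mu st order_refl) auto
    also have "\<dots> = \<delta> * ?N ^ 3" by (simp add: power2_eq_square power3_eq_cube)
    finally show "real (card (cherries V E)) \<le> \<delta> * ?N ^ 3" .
  qed
qed

section \<open>From negative vectors to cuts\<close>

text \<open>Each new vector is sought on the set \<open>U\<close> of vertices whose mass so far is
  at most 1. After \<open>K \<le> k\<close> unit vectors the total mass is \<open>K\<close>, so at
  most \<open>k\<close> vertices lie outside \<open>U\<close>; entries of a unit vector have square
  at most 1, so no mass exceeds 2.\<close>

lemma greedy_negative_vectors:
  fixes A :: "'a \<Rightarrow> 'a \<Rightarrow> real"
  assumes fin: "finite V"
    and neg: "\<And>U. U \<subseteq> V \<Longrightarrow> card (V - U) \<le> k \<Longrightarrow> \<exists>z. quad_form U A z < - \<mu> * ip U z z"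
    and "K \<le> Suc k"
  shows "\<exists>x :: nat \<Rightarrow> 'a \<Rightarrow> real. (\<forall>l<K. ip V (x l) (x l) = 1 \<and> quad_form V A (x l) \<le> - \<mu>) \<and>
    (\<forall>i\<in>V. (\<Sum>l<K. (x l i)\<^sup>2) \<le> 2)"
  using assms(3)
proof (induction K)
  case 0
  show ?case by simp
next
  case (Suc K)
  then obtain x :: "nat \<Rightarrow> 'a \<Rightarrow> real" where x: "\<And>l. l < K \<Longrightarrow> ip V (x l) (x l) = 1"
    "\<And>l. l < K \<Longrightarrow> quad_form V A (x l) \<le> - \<mu>" "\<And>i. i \<in> V \<Longrightarrow> (\<Sum>l<K. (x l i)\<^sup>2) \<le> 2"
    by (metis Suc_leD)
  define U where "U = {i\<in>V. (\<Sum>l<K. (x l i)\<^sup>2) \<le> 1}"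
  have UV: "U \<subseteq> V" by (auto simp: U_def)
  have finU: "finite U" using UV fin finite_subset by blast
  have "real (card (V - U)) * 1 \<le> (\<Sum>i\<in>V - U. \<Sum>l<K. (x l i)\<^sup>2)"
    by (rule sum_bounded_below) (auto simp: U_def)
  also have "\<dots> \<le> (\<Sum>i\<in>V. \<Sum>l<K. (x l i)\<^sup>2)"
    using fin by (intro sum_mono2) (auto intro: sum_nonneg)
  also have "\<dots> = (\<Sum>l<K. ip V (x l) (x l))"
    by (subst sum.swap) (simp add: ip_def power2_eq_square)
  also have "\<dots> = real K" by (simp add: x)
  finally have "card (V - U) \<le> k" using Suc.prems by simp
  then obtain z where z: "quad_form U A z < - \<mu> * ip U z z" using neg[OF UV] by blast
  have "ip U z z \<noteq> 0"
  proof
    assume 0: "ip U z z = 0"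
    then have "z i = 0" if "i \<in> U" for i using ip_self_eq_0[OF finU _ that] by blast
    then have "quad_form U A z = 0" by (simp add: quad_form_def)
    then show False using z 0 by simp
  qed
  then have pos: "ip U z z > 0" using ip_self_nonneg[of U z] by linarith
  define c where "c = 1 / sqrt (ip U z z)"
  have cc: "c * c = 1 / ip U z z" using pos by (simp add: c_def)
  define w where "w i = (if i \<in> U then c * z i else 0)" for i
  have sub: "(\<Sum>i\<in>V. if i \<in> U then f i else 0) = (\<Sum>i\<in>U. f i)" for f :: "'a \<Rightarrow> real"
    using fin UV by (simp add: sum.If_cases Int_absorb1)
  have "ip V w w = (\<Sum>i\<in>V. if i \<in> U then c * c * (z i * z i) else 0)"
    unfolding ip_def w_def by (intro sum.cong refl) (auto simp: mult_ac)
  also have "\<dots> = c * c * ip U z z" unfolding sub by (simp add: ip_def sum_distrib_left)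
  finally have ww: "ip V w w = 1" using pos by (simp add: cc)
  have "quad_form V A w = (\<Sum>i\<in>V. if i \<in> U then (\<Sum>j\<in>V. if j \<in> U then c * c * (A i j * z i * z j) else 0) else 0)"
    unfolding quad_form_def w_def by (intro sum.cong refl) (auto intro!: sum.cong simp: mult_ac)
  also have "\<dots> = c * c * quad_form U A z" unfolding sub by (simp add: quad_form_def sum_distrib_left)
  also have "\<dots> \<le> c * c * (- \<mu> * ip U z z)" using z pos by (intro mult_left_mono) (auto simp: cc)
  finally have qw: "quad_form V A w \<le> - \<mu>" using pos by (simp add: cc)
  have sq: "(\<Sum>l<K. (x l i)\<^sup>2) + (w i)\<^sup>2 \<le> 2" if i: "i \<in> V" for i
  proof (cases "i \<in> U")
    case True
    have "w i * w i \<le> ip V w w" unfolding ip_def by (rule member_le_sum[OF i]) (use fin in auto)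
    then show ?thesis using True ww by (simp add: U_def power2_eq_square)
  next
    case False
    then show ?thesis using x(3)[OF i] by (simp add: w_def)
  qed
  show ?case
    by (intro exI[of _ "x(K := w)"]) (use x ww qw sq in \<open>auto simp: less_Suc_eq\<close>)
qed

text \<open>Averaging \<open>cosh (g + x)\<close> and \<open>cosh (g - x)\<close> gives
  \<open>cosh g * cosh x\<close>; bounding the second factor by an exponential lets the costs of
  successive random signs add up in the exponent.\<close>

lemma cosh_le_exp_square:
  fixes x :: real
  assumes "\<bar>x\<bar> \<le> 1"
  shows "cosh x \<le> exp (x\<^sup>2)"
proof -
  have main: "cosh y \<le> exp (y\<^sup>2)" if y: "0 \<le> y" "y \<le> 1" for y :: real
  proof -
    have 1: "exp y \<le> 1 + y + y\<^sup>2" using exp_bound[OF y] .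
    have low: "1 + y + y\<^sup>2 / 2 \<le> exp y" using exp_lower_Taylor_quadratic[OF y(1)] .
    \<comment> \<open>Since the product in the next line is at least 1,
      \<open>1 - y + y\<^sup>2\<close> bounds \<open>exp (- y)\<close> from above.\<close>
    have "1 \<le> 1 + (y\<^sup>2 / 2 + y ^ 3 / 2 + y ^ 4 / 2)" using y by simp
    also have "\<dots> = (1 - y + y\<^sup>2) * (1 + y + y\<^sup>2 / 2)"
      by (simp add: field_simps power2_eq_square power3_eq_cube power4_eq_xxxx)
    also have "\<dots> \<le> (1 - y + y\<^sup>2) * exp y" using y low by (intro mult_left_mono) auto
    finally have "exp (- y) * 1 \<le> exp (- y) * ((1 - y + y\<^sup>2) * exp y)"
      by (intro mult_left_mono) auto
    then have 2: "exp (- y) \<le> 1 - y + y\<^sup>2"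
      by (simp add: exp_minus field_simps)
    have "cosh y \<le> 1 + y\<^sup>2" using 1 2 by (simp add: cosh_field_def)
    also have "\<dots> \<le> exp (y\<^sup>2)" by (rule exp_ge_add_one_self)
    finally show ?thesis .
  qed
  show ?thesis using main[of "\<bar>x\<bar>"] assms by (cases "x \<ge> 0") auto
qed

lemma quad_form_parallelogram:
  "quad_form V A (\<lambda>i. g i + x i) + quad_form V A (\<lambda>i. g i - x i) = 2 * quad_form V A g + 2 * quad_form V A x"
  unfolding quad_form_def sum_distrib_left sum.distrib[symmetric]
  by (intro sum.cong refl) (simp add: algebra_simps)

text \<open>Derandomised rounding: for random signs the expectation of the left-hand side is at least the
  right-hand side, and the signs can be fixed one at a time.\<close>

lemma exists_signs:
  fixes K :: nat
  assumes "finite V" "\<And>i. i \<in> V \<Longrightarrow> c i \<ge> 0" "\<And>l i. l < K \<Longrightarrow> i \<in> V \<Longrightarrow> \<bar>x l i\<bar> \<le> 1"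
  shows "\<exists>g. - quad_form V A g - (\<Sum>i\<in>V. c i * cosh (g i))
    \<ge> (\<Sum>l<K. - quad_form V A (x l)) - (\<Sum>i\<in>V. c i * exp (\<Sum>l<K. (x l i)\<^sup>2))"
  using assms(2,3)
proof (induction K arbitrary: c)
  case 0
  show ?case by (intro exI[of _ "\<lambda>_. 0"]) (simp add: quad_form_def)
next
  case (Suc K)
  \<comment> \<open>The weights handed to the induction hypothesis absorb the factor that averaging
    over the sign of \<open>x K\<close> costs in the penalty.\<close>
  define c' where "c' i = c i * exp ((x K i)\<^sup>2)" for i
  have "\<exists>g. - quad_form V A g - (\<Sum>i\<in>V. c' i * cosh (g i))
    \<ge> (\<Sum>l<K. - quad_form V A (x l)) - (\<Sum>i\<in>V. c' i * exp (\<Sum>l<K. (x l i)\<^sup>2))"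
    by (rule Suc.IH) (use Suc.prems in \<open>auto simp: c'_def\<close>)
  then obtain g where g: "- quad_form V A g - (\<Sum>i\<in>V. c' i * cosh (g i))
    \<ge> (\<Sum>l<K. - quad_form V A (x l)) - (\<Sum>i\<in>V. c' i * exp (\<Sum>l<K. (x l i)\<^sup>2))" by blast
  define F where "F h = - quad_form V A h - (\<Sum>i\<in>V. c i * cosh (h i))" for h
  define T where "T = (\<Sum>l<Suc K. - quad_form V A (x l)) - (\<Sum>i\<in>V. c i * exp (\<Sum>l<Suc K. (x l i)\<^sup>2))"
  let ?p = "\<lambda>i. g i + x K i" and ?m = "\<lambda>i. g i - x K i"
  have "(\<Sum>i\<in>V. c i * cosh (?p i)) + (\<Sum>i\<in>V. c i * cosh (?m i)) \<le> 2 * (\<Sum>i\<in>V. c' i * cosh (g i))"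
    unfolding sum_distrib_left sum.distrib[symmetric]
  proof (intro sum_mono)
    fix i assume i: "i \<in> V"
    have "c i * cosh (?p i) + c i * cosh (?m i) = 2 * (c i * cosh (g i)) * cosh (x K i)"
      by (simp add: cosh_add cosh_diff algebra_simps)
    also have "\<dots> \<le> 2 * (c i * cosh (g i)) * exp ((x K i)\<^sup>2)"
      using Suc.prems i by (intro mult_left_mono cosh_le_exp_square) (auto intro!: mult_nonneg_nonneg)
    finally show "c i * cosh (?p i) + c i * cosh (?m i) \<le> 2 * (c' i * cosh (g i))"
      by (simp add: c'_def mult_ac)
  qed
  moreover have "T = (\<Sum>l<K. - quad_form V A (x l)) - quad_form V A (x K)
      - (\<Sum>i\<in>V. c' i * exp (\<Sum>l<K. (x l i)\<^sup>2))"
    by (simp add: T_def c'_def exp_add mult_ac)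
  ultimately have "2 * T \<le> F ?p + F ?m"
    using g quad_form_parallelogram[of V A g "x K"] unfolding F_def by linarith
  \<comment> \<open>The better of the two signs does at least as well as the average.\<close>
  then have "T \<le> F ?p \<or> T \<le> F ?m" by linarith
  then show ?case unfolding F_def T_def by blast
qed

text \<open>With zero diagonal the form is affine in each coordinate separately. Hence moving a
  coordinate from \<open>[-1, 1]\<close> to one of the two endpoints does not increase it, which is
  how fractional vectors are rounded.\<close>

lemma quad_form_coordinate:
  assumes "finite V" "\<And>i. i \<in> V \<Longrightarrow> A i i = 0"
  shows "quad_form V A y = (1 + y k) / 2 * quad_form V A (y(k := 1)) + (1 - y k) / 2 * quad_form V A (y(k := - 1))"
  unfolding quad_form_def sum_distrib_left sum.distrib[symmetric]
proof (intro sum.cong refl)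
  fix i j assume "i \<in> V" "j \<in> V"
  then show "A i j * y i * y j = (1 + y k) / 2 * (A i j * (y(k := 1)) i * (y(k := 1)) j)
      + (1 - y k) / 2 * (A i j * (y(k := - 1)) i * (y(k := - 1)) j)"
    using assms(2)[of k] by (auto simp: field_simps)
qed

lemma round_to_signs:
  assumes fin: "finite V" and A: "\<And>i. i \<in> V \<Longrightarrow> A i i = 0" and y: "\<And>i. i \<in> V \<Longrightarrow> \<bar>y i\<bar> \<le> 1"
  shows "\<exists>s. (\<forall>i\<in>V. s i = 1 \<or> s i = - 1) \<and> quad_form V A s \<le> quad_form V A y"
proof -
  have "\<exists>s. (\<forall>i\<in>F. s i = 1 \<or> s i = - 1) \<and> (\<forall>i\<in>V. \<bar>s i\<bar> \<le> 1) \<and> quad_form V A s \<le> quad_form V A y"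
    if "finite F" "F \<subseteq> V" for F using that
  proof (induction F rule: finite_induct)
    case empty
    show ?case using y by (intro exI[of _ y]) auto
  next
    case (insert k F)
    then obtain s where s: "\<forall>i\<in>F. s i = 1 \<or> s i = - 1" "\<forall>i\<in>V. \<bar>s i\<bar> \<le> 1"
      "quad_form V A s \<le> quad_form V A y" by auto
    define p where "p = (1 + s k) / 2"
    have "\<bar>s k\<bar> \<le> 1" using s(2) insert.prems by auto
    then have p: "0 \<le> p" "p \<le> 1" by (auto simp: p_def)
    have "quad_form V A s = p * quad_form V A (s(k := 1)) + (1 - p) * quad_form V A (s(k := - 1))"
      using quad_form_coordinate[where A = A and y = s and k = k, OF fin A] by (simp add: p_def field_simps)
    moreover have "min (quad_form V A (s(k := 1))) (quad_form V A (s(k := - 1)))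
        \<le> p * quad_form V A (s(k := 1)) + (1 - p) * quad_form V A (s(k := - 1))" (is "min ?a ?b \<le> _")
    proof -
      have "p * min ?a ?b + (1 - p) * min ?a ?b \<le> p * ?a + (1 - p) * ?b"
        using p by (intro add_mono mult_left_mono) auto
      then show ?thesis by (simp add: algebra_simps)
    qed
    ultimately have "?a \<le> quad_form V A y \<or> ?b \<le> quad_form V A y" using s(3) by linarith
    then obtain c where c: "c = 1 \<or> c = -1" "quad_form V A (s(k := c)) \<le> quad_form V A y" by auto
    have "\<forall>i\<in>insert k F. (s(k := c)) i = 1 \<or> (s(k := c)) i = - 1" using c(1) s(1) by simp
    moreover have "\<forall>i\<in>V. \<bar>(s(k := c)) i\<bar> \<le> 1" using c(1) s(2) by auto
    ultimately show ?case using c(2) by blast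
  qed
  from this[OF fin] show ?thesis by blast
qed

text \<open>Exponential growth beats quadratic growth:
  \<open>H\<^sup>2 \<le> 8 * exp (H / 2)\<close> leaves a factor \<open>exp (H / 2)\<close> bounded
  by \<open>16 * n\<^sup>2\<close>. It is applied to the largest entry of the combined vector, whose
  \<open>cosh\<close> is part of the penalty.\<close>

lemma cosh_growth_bound:
  fixes G n :: real
  assumes "n \<ge> 1" "cosh G \<le> n\<^sup>2 * G\<^sup>2"
  shows "\<bar>G\<bar> \<le> 2 * ln (16 * n\<^sup>2)"
proof -
  define H where "H = \<bar>G\<bar>"
  have "exp H / 2 \<le> cosh H" by (simp add: cosh_field_def)
  also have "\<dots> = cosh G" by (simp add: H_def abs_if)
  also have "\<dots> \<le> n\<^sup>2 * H\<^sup>2" using assms(2) by (simp add: H_def)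
  also have "H\<^sup>2 \<le> 8 * exp (H / 2)"
    using exp_lower_Taylor_quadratic[of "H / 2"] by (simp add: H_def power_divide)
  finally have "exp H \<le> 16 * n\<^sup>2 * exp (H / 2)" using assms(1) by (simp add: mult_left_mono)
  moreover have "exp H = exp (H / 2) * exp (H / 2)" by (simp add: exp_add[symmetric])
  ultimately have "exp (H / 2) \<le> 16 * n\<^sup>2" by simp
  then have "H / 2 \<le> ln (16 * n\<^sup>2)" using assms(1) by (subst ln_ge_iff) auto
  then show ?thesis by (simp add: H_def)
qed

text \<open>Minus the form at the combined vector \<open>g\<close> is at least the gain
  \<open>\<mu> * K - 9 * card V\<close> plus the penalty; mass at most 2 costs at most
  \<open>exp 2 \<le> 9\<close> per vertex. It is also at most \<open>(card V)\<^sup>2\<close> times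
  the square of the largest entry, so this entry is logarithmic. Dividing \<open>g\<close> by
  \<open>\<Theta>\<close> and rounding to signs then loses only a factor
  \<open>\<Theta>\<^sup>2\<close>.\<close>

lemma exists_negative_sign_vector:
  fixes A :: "'a \<Rightarrow> 'a \<Rightarrow> real"
  assumes fin: "finite V" and ne: "V \<noteq> {}" and A: "\<And>i. i \<in> V \<Longrightarrow> A i i = 0"
    and A1: "\<And>i j. i \<in> V \<Longrightarrow> j \<in> V \<Longrightarrow> \<bar>A i j\<bar> \<le> 1"
    and x: "\<And>l. l < K \<Longrightarrow> ip V (x l) (x l) = 1" "\<And>l. l < K \<Longrightarrow> quad_form V A (x l) \<le> - \<mu>"
      "\<And>i. i \<in> V \<Longrightarrow> (\<Sum>l<K. (x l i)\<^sup>2) \<le> 2"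
    and big: "9 * real (card V) \<le> \<mu> * real K"
  shows "\<exists>s. (\<forall>i\<in>V. s i = 1 \<or> s i = - 1) \<and>
    - quad_form V A s \<ge> (\<mu> * real K - 9 * real (card V)) / (2 * ln (16 * (real (card V))\<^sup>2))\<^sup>2"
proof -
  let ?n = "real (card V)"
  have n1: "?n \<ge> 1" using fin ne by (simp add: Suc_le_eq card_gt_0_iff)
  have abs1: "\<bar>x l i\<bar> \<le> 1" if "l < K" "i \<in> V" for l i
  proof -
    have "x l i * x l i \<le> ip V (x l) (x l)" unfolding ip_def
      by (rule member_le_sum[OF that(2)]) (use fin in auto)
    then have "(x l i)\<^sup>2 \<le> 1" using x(1)[OF that(1)] by (simp add: power2_eq_square)
    then show ?thesis by (simp add: abs_square_le_1)
  qed
  obtain g where g: "- quad_form V A g - (\<Sum>i\<in>V. 1 * cosh (g i))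
    \<ge> (\<Sum>l<K. - quad_form V A (x l)) - (\<Sum>i\<in>V. 1 * exp (\<Sum>l<K. (x l i)\<^sup>2))"
    using exists_signs[OF fin, of "\<lambda>_. 1" K x A] abs1 by auto
  have "real (card {..<K}) * \<mu> \<le> (\<Sum>l<K. - quad_form V A (x l))"
    by (rule sum_bounded_below) (use x(2) in force)
  moreover have "(\<Sum>i\<in>V. 1 * exp (\<Sum>l<K. (x l i)\<^sup>2)) \<le> ?n * 9"
  proof (rule sum_bounded_above)
    fix i assume "i \<in> V"
    then have "exp (\<Sum>l<K. (x l i)\<^sup>2) \<le> exp (1 + 1)" using x(3) by simp
    also have "\<dots> = exp 1 * exp 1" by (rule exp_add)
    also have "\<dots> \<le> 3 * (3::real)" using exp_le by (intro mult_mono) auto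
    finally show "1 * exp (\<Sum>l<K. (x l i)\<^sup>2) \<le> 9" by simp
  qed
  ultimately have q: "- quad_form V A g \<ge> \<mu> * real K - 9 * ?n + (\<Sum>i\<in>V. cosh (g i))"
    using g by (simp add: mult.commute)
  define G where "G = Max ((\<lambda>i. \<bar>g i\<bar>) ` V)"
  have Gle: "\<bar>g i\<bar> \<le> G" if "i \<in> V" for i unfolding G_def using fin that by (intro Max_ge) auto
  have "G \<in> (\<lambda>i. \<bar>g i\<bar>) ` V" unfolding G_def using fin ne by (intro Max_in) auto
  then obtain k where k: "k \<in> V" "G = \<bar>g k\<bar>" by blast
  have "- quad_form V A g = (\<Sum>i\<in>V. \<Sum>j\<in>V. - (A i j * g i * g j))"
    by (simp add: quad_form_def sum_negf)
  also have "\<dots> \<le> (\<Sum>i\<in>V. \<Sum>j\<in>V. G\<^sup>2)"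
  proof (intro sum_mono)
    fix i j assume ij: "i \<in> V" "j \<in> V"
    have "- (A i j * g i * g j) \<le> \<bar>A i j\<bar> * (\<bar>g i\<bar> * \<bar>g j\<bar>)"
      by (metis abs_ge_minus_self abs_mult mult.assoc)
    also have "\<dots> \<le> 1 * (G * G)"
      using A1[OF ij] Gle ij k by (intro mult_mono) auto
    finally show "- (A i j * g i * g j) \<le> G\<^sup>2" by (simp add: power2_eq_square)
  qed
  also have "\<dots> = ?n\<^sup>2 * G\<^sup>2" by (simp add: power2_eq_square)
  finally have up: "- quad_form V A g \<le> ?n\<^sup>2 * G\<^sup>2" .
  have "cosh (g k) \<le> (\<Sum>i\<in>V. cosh (g i))"
    by (rule member_le_sum[OF k(1)]) (use fin in auto)
  \<comment> \<open>By \<open>big\<close> the gain is nonnegative, so minus the form bounds the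
    penalty, in particular its term for the largest entry.\<close>
  then have "cosh (g k) \<le> ?n\<^sup>2 * (g k)\<^sup>2" using q up big k by simp
  then have "\<bar>g k\<bar> \<le> 2 * ln (16 * ?n\<^sup>2)" by (rule cosh_growth_bound[OF n1])
  define \<Theta> where "\<Theta> = 2 * ln (16 * ?n\<^sup>2)"
  have G\<Theta>: "G \<le> \<Theta>" unfolding \<Theta>_def k(2) by fact
  have \<Theta>: "\<Theta> > 0"
  proof -
    have "1 \<le> ?n\<^sup>2" using n1 by simp
    then have "1 < 16 * ?n\<^sup>2" by linarith
    then show ?thesis unfolding \<Theta>_def by (intro mult_pos_pos ln_gt_zero) simp_all
  qed
  define y where "y i = g i / \<Theta>" for i
  have "\<bar>y i\<bar> \<le> 1" if "i \<in> V" for i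
    using Gle[OF that] G\<Theta> \<Theta> by (simp add: y_def abs_divide)
  then obtain s where s: "\<forall>i\<in>V. s i = 1 \<or> s i = - 1" "quad_form V A s \<le> quad_form V A y"
    using round_to_signs[where A = A and y = y, OF fin A] by metis
  have "quad_form V A y = quad_form V A g / \<Theta>\<^sup>2"
    by (simp add: quad_form_def y_def sum_divide_distrib power2_eq_square)
  moreover have "0 \<le> (\<Sum>i\<in>V. cosh (g i))" by (intro sum_nonneg) simp
  then have "(\<mu> * real K - 9 * ?n) / \<Theta>\<^sup>2 \<le> (- quad_form V A g) / \<Theta>\<^sup>2"
    using q by (intro divide_right_mono) auto
  ultimately show ?thesis using s unfolding \<Theta>_def[symmetric] by (intro exI[of _ s]) auto
qed

section \<open>Sign vectors as cuts\<close>

lemma sum_ordered_pairs: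
  fixes f :: "'a set \<Rightarrow> real"
  assumes fin: "finite V" and F: "\<And>e. e \<in> F \<Longrightarrow> e \<subseteq> V \<and> card e = 2"
  shows "(\<Sum>i\<in>V. \<Sum>j\<in>V. if {i, j} \<in> F then f {i, j} else 0) = 2 * (\<Sum>e\<in>F. f e)"
proof -
  define P where "P = {p\<in>V \<times> V. {fst p, snd p} \<in> F}"
  have finF: "finite F" by (rule finite_subset[of _ "Pow V"]) (use F fin in auto)
  have finP: "finite P" using fin by (simp add: P_def)
  have "(\<Sum>i\<in>V. \<Sum>j\<in>V. if {i, j} \<in> F then f {i, j} else 0)
      = (\<Sum>p\<in>V \<times> V. if {fst p, snd p} \<in> F then f {fst p, snd p} else 0)"
    by (simp add: sum.cartesian_product case_prod_beta)
  also have "\<dots> = (\<Sum>p\<in>P. f {fst p, snd p})"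
    unfolding P_def using fin by (intro sum.inter_filter[symmetric]) simp
  also have "\<dots> = (\<Sum>e\<in>F. \<Sum>p\<in>{p\<in>P. {fst p, snd p} = e}. f {fst p, snd p})"
    by (rule sum.group[symmetric, OF finP finF]) (auto simp: P_def)
  also have "\<dots> = (\<Sum>e\<in>F. 2 * f e)"
  proof (intro sum.cong refl)
    fix e assume e: "e \<in> F"
    then obtain a b where ab: "e = {a, b}" "a \<noteq> b" using F by (metis card_2_iff)
    have "{a, b} \<in> F" "{b, a} \<in> F" "a \<in> V" "b \<in> V"
      using F[OF e] e unfolding ab(1) by (simp_all add: insert_commute)
    then have "{p\<in>P. {fst p, snd p} = e} = {(a, b), (b, a)}"
      unfolding P_def ab(1) by (auto simp: doubleton_eq_iff)
    then show "(\<Sum>p\<in>{p\<in>P. {fst p, snd p} = e}. f {fst p, snd p}) = 2 * f e"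
      using ab by (simp add: insert_commute)
  qed
  finally show ?thesis by (simp add: sum_distrib_left)
qed

text \<open>Cut between the two signs. Over ordered pairs a crossing edge contributes -2 to the form
  and any other edge 2, so the form is twice the number of edges minus four times the size of the
  cut.\<close>

lemma surplus_ge_quad_form:
  assumes G: "simple_graph G" and s: "\<forall>i\<in>verts G. s i = 1 \<or> s i = - 1"
  shows "surplus G \<ge> - quad_form (verts G) (\<lambda>i j. of_bool ({i, j} \<in> edges G)) s / 4"
proof -
  let ?V = "verts G" and ?F = "edges G"
  have fin: "finite ?V" and F: "\<And>e. e \<in> ?F \<Longrightarrow> e \<subseteq> ?V \<and> card e = 2"
    using G by (auto simp: simple_graph_def)
  have finF: "finite ?F" by (rule finite_subset[of _ "Pow ?V"]) (use F fin in auto)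
  define S where "S = {i\<in>?V. s i = 1}"
  define H where "H = \<lparr>verts = ?V, edges = {e\<in>?F. e \<inter> S \<noteq> {} \<and> e - S \<noteq> {}}\<rparr>"
  define f where "f e = (1 - 2 * of_bool (e \<in> edges H) :: real)" for e
  have "quad_form ?V (\<lambda>i j. of_bool ({i, j} \<in> ?F)) s = (\<Sum>i\<in>?V. \<Sum>j\<in>?V. if {i, j} \<in> ?F then f {i, j} else 0)"
    unfolding quad_form_def
  proof (intro sum.cong refl)
    fix i j assume ij: "i \<in> ?V" "j \<in> ?V"
    then have "s i = 1 \<or> s i = - 1" "s j = 1 \<or> s j = - 1" using s by auto
    then show "of_bool ({i, j} \<in> ?F) * s i * s j = (if {i, j} \<in> ?F then f {i, j} else 0)"
      using ij by (auto simp: f_def H_def S_def)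
  qed
  also have "\<dots> = 2 * (\<Sum>e\<in>?F. f e)" by (rule sum_ordered_pairs[OF fin F])
  also have "(\<Sum>e\<in>?F. f e) = real (card ?F) - 2 * real (card (edges H))"
  proof -
    have "(\<Sum>e\<in>?F. of_bool (e \<in> edges H) :: real) = real (card (?F \<inter> edges H))"
      using finF by (simp add: of_bool_def sum.If_cases)
    moreover have "?F \<inter> edges H = edges H" by (auto simp: H_def)
    ultimately show ?thesis by (simp add: f_def sum_subtractf sum_distrib_left[symmetric])
  qed
  finally have q: "quad_form ?V (\<lambda>i j. of_bool ({i, j} \<in> ?F)) s = 2 * real (card ?F) - 4 * real (card (edges H))"
    by simp
  have "subgraph_of H G" using G by (auto simp: subgraph_of_def H_def simple_graph_def)
  moreover have "bipartite H"
    unfolding bipartite_def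
  proof (rule exI[of _ S], rule exI[of _ "?V - S"], intro conjI ballI)
    fix e assume e: "e \<in> edges H"
    then obtain a b where ab: "a \<in> e" "a \<in> S" "b \<in> e" "b \<notin> S" by (auto simp: H_def)
    have "e \<subseteq> ?V" "card e = 2" using e F by (auto simp: H_def)
    then obtain c d where "e = {c, d}" by (metis card_2_iff)
    then have "e = {a, b}" using ab by auto
    then show "\<exists>a\<in>S. \<exists>b\<in>?V - S. e = {a, b}" using ab \<open>e \<subseteq> ?V\<close> by auto
  qed (auto simp: S_def H_def)
  ultimately have mem: "card (edges H) \<in> {card (edges H) | H. subgraph_of H G \<and> bipartite H}" by blast
  have "finite {card (edges H) | H. subgraph_of H G \<and> bipartite H}"
    by (rule finite_subset[of _ "{..card ?F}"]) (auto simp: subgraph_of_def intro: card_mono[OF finF])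
  then have "card (edges H) \<le> max_cut G" unfolding max_cut_def using mem by (rule Max_ge)
  then show ?thesis using q by (simp add: surplus_def)
qed

section \<open>Disjoint unions of cliques\<close>

text \<open>A disjoint union of cliques is encoded by a labelling \<open>c\<close> whose fibres are
  the cliques. Pairs are ordered, so for symmetric \<open>E\<close> every edge to be changed counts
  twice.\<close>

definition cluster_edits :: "'a set \<Rightarrow> ('a \<Rightarrow> 'a \<Rightarrow> bool) \<Rightarrow> ('a \<Rightarrow> 'a) \<Rightarrow> ('a \<times> 'a) set" where
  "cluster_edits U E c = {(i, j). i \<in> U \<and> j \<in> U \<and> i \<noteq> j \<and> E i j \<noteq> (c i = c j)}"

lemma finite_cherries: "finite V \<Longrightarrow> finite (cherries V E)"
  by (rule finite_subset[of _ "V \<times> V \<times> V"]) (auto simp: cherries_def)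

lemma cherries_mono: "U \<subseteq> V \<Longrightarrow> cherries U E \<subseteq> cherries V E"
  by (auto simp: cherries_def)

lemma sum_card_fibres:
  assumes "finite U" "finite X" "\<And>p. p \<in> X \<Longrightarrow> f p \<in> U"
  shows "(\<Sum>v\<in>U. card {p\<in>X. f p = v}) = card X"
  using sum.group[OF assms(2,1), of f "\<lambda>_. 1::nat"] assms(3) by (auto simp: image_subset_iff)

text \<open>Induction on \<open>card U\<close>. If at most \<open>\<kappa>\<close> ordered pairs are
  adjacent, all edges are removed. Otherwise, by averaging, some \<open>v\<close> has cherry weight
  at most \<open>\<eta>\<close> times its degree; its closed neighbourhood is made a clique and cut
  off, and the cost is charged to the vertices removed.\<close>

lemma few_cherries_imp_few_cluster_edits:
  fixes \<kappa> \<eta> :: real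
  assumes fin: "finite U" and sym: "\<And>i j. i \<in> U \<Longrightarrow> j \<in> U \<Longrightarrow> E i j = E j i"
    and irr: "\<And>i. i \<in> U \<Longrightarrow> \<not> E i i"
    and ch: "3 * real (card (cherries U E)) \<le> \<kappa> * \<eta>" and pos: "\<kappa> > 0" "\<eta> > 0"
  shows "\<exists>c. c ` U \<subseteq> U \<and> real (card (cluster_edits U E c)) \<le> \<kappa> + \<eta> * real (card U)"
  using fin sym irr ch
proof (induction "card U" arbitrary: U rule: less_induct)
  case less
  note fin = less.prems(1) and sym = less.prems(2) and irr = less.prems(3) and ch = less.prems(4)
  define P where "P = {(i, j). i \<in> U \<and> j \<in> U \<and> E i j}"
  have finP: "finite P" by (rule finite_subset[of _ "U \<times> U"]) (use fin in \<open>auto simp: P_def\<close>)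
  define X where "X = cherries U E"
  have finX: "finite X" unfolding X_def by (rule finite_cherries[OF fin])
  show ?case
  proof (cases "real (card P) \<le> \<kappa>")
    case True
    have "cluster_edits U E id \<subseteq> P" by (auto simp: cluster_edits_def P_def)
    then have "card (cluster_edits U E id) \<le> card P" using finP by (rule card_mono[rotated])
    moreover have "0 \<le> \<eta> * real (card U)" using pos by simp
    ultimately show ?thesis using True by (intro exI[of _ id]) auto
  next
    case False
    define d where "d v = card {p\<in>P. fst p = v}" for v
    \<comment> \<open>Cherries centred at \<open>v\<close> are the missing pairs inside its
      neighbourhood; those starting at \<open>v\<close> are the edges leaving it, doubled to cover
      both orders. Summed over \<open>v\<close>, every cherry counts three times.\<close>
    define w where "w v = card {p\<in>X. fst (snd p) = v} + 2 * card {p\<in>X. fst p = v}" for v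
    have sd: "(\<Sum>v\<in>U. d v) = card P" unfolding d_def
      by (rule sum_card_fibres[OF fin finP]) (auto simp: P_def)
    have sw: "(\<Sum>v\<in>U. w v) = 3 * card X"
    proof -
      have "(\<Sum>v\<in>U. card {p\<in>X. fst (snd p) = v}) = card X" "(\<Sum>v\<in>U. card {p\<in>X. fst p = v}) = card X"
        by (rule sum_card_fibres[OF fin finX], force simp: X_def cherries_def)+
      then show ?thesis by (simp add: w_def sum.distrib sum_distrib_left[symmetric])
    qed
    have "\<exists>v\<in>U. real (w v) \<le> \<eta> * real (d v)"
    proof (rule ccontr)
      assume "\<not> ?thesis"
      then have "(\<Sum>v\<in>U. \<eta> * real (d v)) \<le> (\<Sum>v\<in>U. real (w v))"
        by (intro sum_mono) (auto simp: not_le intro: less_imp_le)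
      then have "\<eta> * real (card P) \<le> 3 * real (card X)"
        unfolding sum_distrib_left[symmetric] of_nat_sum[symmetric] sd sw by simp
      then have "\<eta> * real (card P) \<le> \<eta> * \<kappa>" using ch by (simp add: X_def mult.commute)
      then show False using False pos by simp
    qed
    then obtain v where v: "v \<in> U" "real (w v) \<le> \<eta> * real (d v)" by blast
    define N where "N = {i\<in>U. E v i}"
    define U' where "U' = U - insert v N"
    have vN: "v \<notin> N" using irr v by (auto simp: N_def)
    have finN: "finite N" and NU: "N \<subseteq> U" using fin by (auto simp: N_def)
    have dN: "d v = card N"
    proof -
      have "{p\<in>P. fst p = v} = Pair v ` N" using v(1) by (auto simp: P_def N_def)
      then show ?thesis by (simp add: d_def card_image inj_on_def)
    qed
    have U': "U' \<subseteq> U" "finite U'" using fin by (auto simp: U'_def)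
    have cU: "card U = card U' + card N + 1"
    proof -
      have "card U' = card U - card (insert v N)"
        unfolding U'_def using finN NU v(1) by (intro card_Diff_subset) auto
      moreover have "card (insert v N) \<le> card U" using fin NU v(1) by (intro card_mono) auto
      ultimately show ?thesis using vN finN by simp
    qed
    have "card (cherries U' E) \<le> card (cherries U E)"
      by (rule card_mono[OF finite_cherries[OF fin] cherries_mono[OF U'(1)]])
    then have ch': "3 * real (card (cherries U' E)) \<le> \<kappa> * \<eta>" using ch by linarith
    have "\<exists>c. c ` U' \<subseteq> U' \<and> real (card (cluster_edits U' E c)) \<le> \<kappa> + \<eta> * real (card U')"
    proof (rule less.hyps)
      show "E i j = E j i" if "i \<in> U'" "j \<in> U'" for i j using that U'(1) by (intro sym) auto
      show "\<not> E i i" if "i \<in> U'" for i using that U'(1) by (intro irr) auto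
    qed (use cU U' ch' in auto)
    then obtain c where c: "c ` U' \<subseteq> U'" "real (card (cluster_edits U' E c)) \<le> \<kappa> + \<eta> * real (card U')"
      by blast
    \<comment> \<open>\<open>v\<close> is a fresh label, since \<open>c\<close> maps
      \<open>U'\<close> into itself and \<open>v\<close> is not in \<open>U'\<close>. This is why
      the image condition is part of the claim.\<close>
    define c' where "c' i = (if i \<in> insert v N then v else c i)" for i
    let ?C = "(\<lambda>p. (fst p, snd (snd p))) ` {p\<in>X. fst (snd p) = v}"
    let ?D = "snd ` {p\<in>X. fst p = v}"
    let ?D' = "(\<lambda>p. (snd (snd p), fst (snd p))) ` {p\<in>X. fst p = v}"
    have sub: "cluster_edits U E c' \<subseteq> cluster_edits U' E c \<union> (?C \<union> (?D \<union> ?D'))"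
    proof
      fix q assume q: "q \<in> cluster_edits U E c'"
      obtain i j where ij: "q = (i, j)" by (cases q)
      have m: "i \<in> U" "j \<in> U" "i \<noteq> j" "E i j \<noteq> (c' i = c' j)" using q ij by (auto simp: cluster_edits_def)
      have vc: "c k \<noteq> v" if "k \<in> U'" for k using c(1) that by (auto simp: U'_def)
      consider "i \<in> insert v N" "j \<in> insert v N" | "i \<in> insert v N" "j \<in> U'"
        | "i \<in> U'" "j \<in> insert v N" | "i \<in> U'" "j \<in> U'" using m by (auto simp: U'_def)
      then show "q \<in> cluster_edits U' E c \<union> (?C \<union> (?D \<union> ?D'))"
      proof cases
        case 1
        then have nE: "\<not> E i j" using m by (auto simp: c'_def)
        then have "i \<in> N" "j \<in> N" using 1 m sym v(1) by (auto simp: N_def)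
        then have "(i, v, j) \<in> X" using nE m sym[of i v] v(1) by (auto simp: X_def cherries_def N_def)
        then have "q \<in> ?C" unfolding ij by (intro image_eqI[of _ _ "(i, v, j)"]) auto
        then show ?thesis by blast
      next
        case 2
        then have e: "E i j" using m vc by (auto simp: c'_def U'_def)
        have "\<not> E v j" "j \<noteq> v" using 2 m by (auto simp: U'_def N_def)
        then have "i \<in> N" using e 2 by auto
        then have "(v, i, j) \<in> X" using e m v(1) \<open>\<not> E v j\<close> \<open>j \<noteq> v\<close> by (auto simp: X_def cherries_def N_def)
        then have "q \<in> ?D" unfolding ij by (intro image_eqI[of _ _ "(v, i, j)"]) auto
        then show ?thesis by blast
      next
        case 3
        then have e: "E j i" using m vc sym[of i j] by (auto simp: c'_def U'_def)
        have "\<not> E v i" "i \<noteq> v" using 3 m by (auto simp: U'_def N_def)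
        then have "j \<in> N" using e 3 by auto
        then have "(v, j, i) \<in> X" using e m v(1) \<open>\<not> E v i\<close> \<open>i \<noteq> v\<close> by (auto simp: X_def cherries_def N_def)
        then have "q \<in> ?D'" unfolding ij by (intro image_eqI[of _ _ "(v, j, i)"]) auto
        then show ?thesis by blast
      next
        case 4
        then have "c' i = c i" "c' j = c j" by (auto simp: c'_def U'_def)
        then show ?thesis using 4 m ij by (auto simp: cluster_edits_def)
      qed
    qed
    have finE: "finite (cluster_edits U' E c)"
      by (rule finite_subset[of _ "U' \<times> U'"]) (use U' in \<open>auto simp: cluster_edits_def\<close>)
    have "card (cluster_edits U E c') \<le> card (cluster_edits U' E c \<union> (?C \<union> (?D \<union> ?D')))"
      using sub finE finX by (intro card_mono) auto
    also have "\<dots> \<le> card (cluster_edits U' E c) + (card ?C + (card ?D + card ?D'))"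
      by (meson add_left_mono card_Un_le order_trans)
    also have "\<dots> \<le> card (cluster_edits U' E c) + w v"
    proof -
      have "card ?C \<le> card {p\<in>X. fst (snd p) = v}" "card ?D \<le> card {p\<in>X. fst p = v}"
        "card ?D' \<le> card {p\<in>X. fst p = v}" using finX by (auto intro: card_image_le)
      then show ?thesis by (simp add: w_def)
    qed
    finally have "real (card (cluster_edits U E c')) \<le> real (card (cluster_edits U' E c)) + real (w v)"
      by linarith
    also have "\<dots> \<le> \<kappa> + \<eta> * real (card U') + \<eta> * real (card N)"
      using c(2) v(2) dN by simp
    also have "\<dots> \<le> \<kappa> + \<eta> * real (card U)" using pos unfolding cU by (simp add: algebra_simps)
    finally have "real (card (cluster_edits U E c')) \<le> \<kappa> + \<eta> * real (card U)" .
    moreover have "c' ` U \<subseteq> U" using c(1) v(1) U'(1) by (auto simp: c'_def U'_def)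
    ultimately show ?thesis by blast
  qed
qed

lemma few_cherries_imp_eps_close:
  fixes G :: "'a graph"
  assumes G: "simple_graph G" and \<epsilon>: "\<epsilon> > 0" and ne: "verts G \<noteq> {}"
    and ch: "3 * real (card (cherries (verts G) (\<lambda>i j. {i, j} \<in> edges G))) \<le> \<epsilon>\<^sup>2 * real (card (verts G)) ^ 3"
  shows "\<exists>H::'a graph. disjoint_union_of_cliques H \<and> card (verts H) = card (verts G) \<and> eps_close \<epsilon> G H"
proof -
  let ?V = "verts G" and ?E = "\<lambda>i j. {i, j} \<in> edges G" and ?n = "real (card (verts G))"
  have fin: "finite ?V" and F: "\<And>e. e \<in> edges G \<Longrightarrow> e \<subseteq> ?V \<and> card e = 2"
    using G by (auto simp: simple_graph_def)
  have n: "?n > 0" using fin ne by (simp add: card_gt_0_iff)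
  \<comment> \<open>The choice \<open>\<kappa> = \<epsilon> n\<^sup>2\<close> and
    \<open>\<eta> = \<epsilon> n\<close> gives \<open>2 \<epsilon> n\<^sup>2\<close> ordered edits,
    that is \<open>\<epsilon> n\<^sup>2\<close> edges.\<close>
  have "\<exists>c. c ` ?V \<subseteq> ?V \<and> real (card (cluster_edits ?V ?E c)) \<le> \<epsilon> * ?n\<^sup>2 + \<epsilon> * ?n * ?n"
  proof (rule few_cherries_imp_few_cluster_edits[OF fin])
    show "3 * real (card (cherries ?V ?E)) \<le> \<epsilon> * ?n\<^sup>2 * (\<epsilon> * ?n)"
      using ch by (simp add: power2_eq_square power3_eq_cube mult_ac)
    show "\<not> ?E i i" for i using F[of "{i, i}"] by auto
  qed (use \<epsilon> n in \<open>auto simp: insert_commute\<close>)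
  then obtain c where c: "real (card (cluster_edits ?V ?E c)) \<le> 2 * (\<epsilon> * ?n\<^sup>2)"
    by (auto simp: power2_eq_square mult.assoc)
  define H where "H = \<lparr>verts = ?V, edges = {{i, j} | i j. i \<in> ?V \<and> j \<in> ?V \<and> i \<noteq> j \<and> c i = c j}\<rparr>"
  have vH: "verts H = ?V" by (simp add: H_def)
  have eH: "{i, j} \<in> edges H \<longleftrightarrow> i \<in> ?V \<and> j \<in> ?V \<and> i \<noteq> j \<and> c i = c j" for i j
    by (auto simp: H_def doubleton_eq_iff)
  have sH: "simple_graph H" using fin by (auto simp: simple_graph_def H_def)
  have cliques: "disjoint_union_of_cliques H"
    unfolding disjoint_union_of_cliques_def
  proof (intro conjI sH ballI)
    fix K assume "K \<in> connected_components H"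
    then obtain v where v: "v \<in> ?V" and K: "K = induced_subgraph H (component_of H v)"
      by (auto simp: connected_components_def vH)
    \<comment> \<open>Edges of \<open>H\<close> join equal labels, so labels are constant along
      paths.\<close>
    have comp: "u \<in> ?V \<and> c u = c v" if "(v, u) \<in> (adj_rel H)\<^sup>*" for u
      using that by (induction rule: rtrancl_induct) (use v in \<open>auto simp: adj_rel_def eH\<close>)
    show "complete_graph K"
      unfolding complete_graph_def
    proof (intro set_eqI iffI)
      fix e assume "e \<in> edges K"
      then have e: "e \<in> edges H" "e \<subseteq> verts K" by (auto simp: K induced_subgraph_def)
      then obtain i j where "e = {i, j}" "i \<noteq> j" by (auto simp: H_def)
      then show "e \<in> {{u, v} | u v. u \<in> verts K \<and> v \<in> verts K \<and> u \<noteq> v}" using e by blast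
    next
      fix e assume "e \<in> {{u, v} | u v. u \<in> verts K \<and> v \<in> verts K \<and> u \<noteq> v}"
      then obtain i j where e: "e = {i, j}" "i \<in> verts K" "j \<in> verts K" "i \<noteq> j" by blast
      then have "(v, i) \<in> (adj_rel H)\<^sup>*" "(v, j) \<in> (adj_rel H)\<^sup>*"
        by (simp_all add: K induced_subgraph_def component_of_def)
      then have "e \<in> edges H" using comp[of i] comp[of j] e by (simp add: eH)
      then show "e \<in> edges K" using e by (simp add: K induced_subgraph_def)
    qed
  qed
  let ?S = "(edges H - edges G) \<union> (edges G - edges H)"
  have S: "e \<subseteq> ?V \<and> card e = 2" if "e \<in> ?S" for e
    using that F sH vH by (auto simp: simple_graph_def)
  have finS: "finite ?S" by (rule finite_subset[of _ "Pow ?V"]) (use S fin in auto)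
  have "2 * real (card ?S) = 2 * (\<Sum>e\<in>?S. 1)" by simp
  also have "\<dots> = (\<Sum>i\<in>?V. \<Sum>j\<in>?V. if {i, j} \<in> ?S then 1 else 0)"
    by (rule sum_ordered_pairs[OF fin S, symmetric])
  also have "\<dots> = (\<Sum>p\<in>?V \<times> ?V. if {fst p, snd p} \<in> ?S then 1 else 0)"
    unfolding sum.cartesian_product case_prod_beta by (rule refl)
  also have "\<dots> = (\<Sum>p\<in>{p\<in>?V \<times> ?V. {fst p, snd p} \<in> ?S}. 1)"
    using fin by (intro sum.inter_filter[symmetric]) simp
  also have "\<dots> = real (card {p\<in>?V \<times> ?V. {fst p, snd p} \<in> ?S})" by simp
  also have "{p\<in>?V \<times> ?V. {fst p, snd p} \<in> ?S} = cluster_edits ?V ?E c"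
  proof -
    have "{i, i} \<notin> edges G" for i using F[of "{i, i}"] by auto
    then show ?thesis by (auto simp: cluster_edits_def eH)
  qed
  finally have "real (card ?S) \<le> \<epsilon> * ?n\<^sup>2" using c by simp
  moreover have "card ?S = card (edges H - edges G) + card (edges G - edges H)"
    using finS by (intro card_Un_disjoint) auto
  moreover have "isomorphic H H"
    unfolding isomorphic_def by (intro exI[of _ id]) auto
  ultimately have "eps_close \<epsilon> G H"
    unfolding eps_close_def using sH vH by (intro exI[of _ H]) auto
  then show ?thesis using cliques vH by metis
qed

section \<open>Deletion of vertices and choice of parameters\<close>

lemma card_cherries_delete:
  assumes "finite V" "U \<subseteq> V"
  shows "card (cherries V E) \<le> card (cherries U E) + 3 * (card (V - U) * (card V)\<^sup>2)"
proof -
  let ?W = "V - U"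
  have "cherries V E \<subseteq> cherries U E \<union> (?W \<times> V \<times> V \<union> (V \<times> ?W \<times> V \<union> V \<times> V \<times> ?W))"
    by (auto simp: cherries_def)
  then have "card (cherries V E) \<le> card (cherries U E \<union> (?W \<times> V \<times> V \<union> (V \<times> ?W \<times> V \<union> V \<times> V \<times> ?W)))"
    using assms finite_subset[OF assms(2,1)] by (intro card_mono) (auto intro: finite_cherries)
  also have "\<dots> \<le> card (cherries U E) + (card (?W \<times> V \<times> V) + (card (V \<times> ?W \<times> V) + card (V \<times> V \<times> ?W)))"
    by (meson add_left_mono card_Un_le order_trans)
  also have "\<dots> = card (cherries U E) + 3 * (card ?W * (card V)\<^sup>2)"
    by (simp add: card_cartesian_product power2_eq_square)
  finally show ?thesis .
qed

theorem theorem1p5: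
  shows "\<forall>\<epsilon>::real. \<epsilon> > 0 \<longrightarrow> (\<exists>n\<^sub>0::nat. \<forall>n\<ge>n\<^sub>0. \<forall>G::'a graph.
    simple_graph G \<and> card (verts G) = n \<and>
    (\<forall>H::'a graph. disjoint_union_of_cliques H \<and> card (verts H) = n \<longrightarrow> eps_far \<epsilon> G H)
    \<longrightarrow> surplus G \<ge> real n powr (1 + 1 / 100))"
proof (intro allI impI)
  fix \<epsilon> :: real assume \<epsilon>: "\<epsilon> > 0"
  \<comment> \<open>\<open>3 * \<delta> \<le> \<epsilon>\<^sup>2\<close> matches
    \<open>few_cherries_imp_eps_close\<close>, and \<open>\<delta> \<le> 1\<close> leaves at least
    half of the vertices after deleting \<open>\<delta> n / 6\<close> of them.\<close>
  define \<delta> where "\<delta> = min 1 (\<epsilon>\<^sup>2 / 3)"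
  have \<delta>: "\<delta> > 0" "\<delta> \<le> 1" "3 * \<delta> \<le> \<epsilon>\<^sup>2" using \<epsilon> by (auto simp: \<delta>_def)
  obtain N\<^sub>0 :: nat where "\<forall>(U::'a set) E \<mu>. finite U \<and> card U \<ge> N\<^sub>0 \<and>
    (\<forall>i\<in>U. \<forall>j\<in>U. E i j = E j i) \<and> (\<forall>i\<in>U. \<not> E i i) \<and> \<mu> \<ge> 1 \<and> \<mu> ^ 6 \<le> real (card U) \<and>
    (\<forall>z. quad_form U (\<lambda>i j. of_bool (E i j)) z \<ge> - \<mu> * ip U z z)
    \<longrightarrow> real (card (cherries U E)) \<le> \<delta> / 2 * real (card U) ^ 3"
    using few_cherries_if_small_negative_eigenvalues[where ?'a = 'a, OF half_gt_zero[OF \<delta>(1)]] by (elim exE)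
  note N\<^sub>0 = this[rule_format, OF conjI, OF _ conjI, OF _ _ conjI, OF _ _ _ conjI,
      OF _ _ _ _ conjI, OF _ _ _ _ _ conjI]
  \<comment> \<open>With \<open>\<mu> = n powr (1/8)\<close> and about \<open>\<delta> n / 6\<close>
    vectors the gain has order \<open>n powr (9/8)\<close>: it beats the linear cost, and dividing
    by a squared logarithm still leaves more than \<open>n powr (1 + 1/100)\<close>. The
    \<open>- 1\<close> is the loss from rounding down.\<close>
  have "eventually (\<lambda>n::nat. 9 * real n \<le> real n powr (1/8) * (\<delta> * real n / 6 - 1)) at_top"
    using \<delta>(1) by real_asymp
  moreover have "eventually (\<lambda>n::nat. real n powr (1 + 1 / 100) \<le>
      (real n powr (1/8) * (\<delta> * real n / 6 - 1) - 9 * real n) / (2 * ln (16 * (real n)\<^sup>2))\<^sup>2 / 4) at_top"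
    using \<delta>(1) by real_asymp
  moreover have "eventually (\<lambda>n::nat. (real n powr (1/8)) ^ 6 \<le> real n / 2) at_top"
    by real_asymp
  ultimately have "eventually (\<lambda>n::nat. n \<ge> 2 * N\<^sub>0 + 1 \<and> 9 * real n \<le> real n powr (1/8) * (\<delta> * real n / 6 - 1) \<and>
      real n powr (1 + 1 / 100) \<le>
      (real n powr (1/8) * (\<delta> * real n / 6 - 1) - 9 * real n) / (2 * ln (16 * (real n)\<^sup>2))\<^sup>2 / 4 \<and>
      (real n powr (1/8)) ^ 6 \<le> real n / 2) at_top"
    by (intro eventually_conj eventually_ge_at_top)
  then obtain n\<^sub>0 where n\<^sub>0: "\<And>n. n \<ge> n\<^sub>0 \<Longrightarrow> n \<ge> 2 * N\<^sub>0 + 1"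
    "\<And>n. n \<ge> n\<^sub>0 \<Longrightarrow> 9 * real n \<le> real n powr (1/8) * (\<delta> * real n / 6 - 1)"
    "\<And>n. n \<ge> n\<^sub>0 \<Longrightarrow> real n powr (1 + 1 / 100) \<le>
      (real n powr (1/8) * (\<delta> * real n / 6 - 1) - 9 * real n) / (2 * ln (16 * (real n)\<^sup>2))\<^sup>2 / 4"
    "\<And>n. n \<ge> n\<^sub>0 \<Longrightarrow> (real n powr (1/8)) ^ 6 \<le> real n / 2"
    unfolding eventually_at_top_linorder by blast
  show "\<exists>n\<^sub>0::nat. \<forall>n\<ge>n\<^sub>0. \<forall>G::'a graph.
    simple_graph G \<and> card (verts G) = n \<and>
    (\<forall>H::'a graph. disjoint_union_of_cliques H \<and> card (verts H) = n \<longrightarrow> eps_far \<epsilon> G H)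
    \<longrightarrow> surplus G \<ge> real n powr (1 + 1 / 100)"
  proof (intro exI[of _ n\<^sub>0] allI impI, elim conjE)
    fix n :: nat and G :: "'a graph"
    assume n: "n \<ge> n\<^sub>0" and G: "simple_graph G" and cV: "card (verts G) = n"
      and far: "\<forall>H::'a graph. disjoint_union_of_cliques H \<and> card (verts H) = n \<longrightarrow> eps_far \<epsilon> G H"
    define V where "V = verts G"
    define E where "E i j \<longleftrightarrow> {i, j} \<in> edges G" for i j
    define A where "A i j = (of_bool (E i j) :: real)" for i j
    define \<mu> where "\<mu> = real n powr (1/8)"
    define k where "k = nat \<lfloor>\<delta> * real n / 6\<rfloor>"
    note big = n\<^sub>0[OF n]
    have n1: "n \<ge> 1" using big(1) by simp
    have fin: "finite V" and cardV: "card V = n" using G cV by (auto simp: simple_graph_def V_def)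
    have ne: "V \<noteq> {}" using cardV n1 by auto
    have irr: "\<not> E i i" for i using G by (auto simp: E_def simple_graph_def)
    have sym: "E i j = E j i" for i j by (simp add: E_def insert_commute)
    have \<mu>: "\<mu> \<ge> 1" using n1 by (simp add: \<mu>_def ge_one_powr_ge_zero)
    have many: "real (card (cherries V E)) > \<delta> * real n ^ 3"
    proof (rule ccontr)
      assume "\<not> ?thesis"
      then have "3 * real (card (cherries V E)) \<le> 3 * \<delta> * real n ^ 3" by simp
      also have "\<dots> \<le> \<epsilon>\<^sup>2 * real n ^ 3" using \<delta>(3) by (intro mult_right_mono) auto
      finally have "\<exists>H::'a graph. disjoint_union_of_cliques H \<and> card (verts H) = card (verts G) \<and> eps_close \<epsilon> G H"
        using ne cV by (intro few_cherries_imp_eps_close[OF G \<epsilon>]) (auto simp: V_def E_def[abs_def])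
      then show False using far cV by auto
    qed
    have kle: "real k \<le> \<delta> * real n / 6" unfolding k_def using \<delta>(1) by (intro of_nat_floor) simp
    have neg: "\<exists>z. quad_form U A z < - \<mu> * ip U z z" if U: "U \<subseteq> V" "card (V - U) \<le> k" for U
    proof (rule ccontr)
      assume "\<not> ?thesis"
      then have psd: "\<forall>z. quad_form U (\<lambda>i j. of_bool (E i j)) z \<ge> - \<mu> * ip U z z"
        by (auto simp: A_def[abs_def] not_less)
      have finU: "finite U" using fin U finite_subset by blast
      have cd: "card (V - U) = n - card U" "card U \<le> n"
        using card_Diff_subset[OF finU U(1)] card_mono[OF fin U(1)] cardV by auto
      have dn: "\<delta> * real n / 6 \<le> real n / 2" using \<delta>(2) mult_right_mono[of \<delta> 1 "real n"] by simp
      \<comment> \<open>At least half of the vertices remain, hence at least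
        \<open>N\<^sub>0\<close>, and \<open>\<mu> ^ 6 \<le> n / 2\<close> is at most
        \<open>card U\<close>; so the spectral estimate applies to \<open>U\<close>.\<close>
      have half: "real n / 2 \<le> real (card U)"
        using U(2) cd kle dn by linarith
      have "real (card (cherries U E)) \<le> \<delta> / 2 * real (card U) ^ 3"
        using half big(1,4) \<mu> psd sym irr finU by (intro N\<^sub>0[where \<mu> = \<mu>]) (auto simp: \<mu>_def)
      also have "\<dots> \<le> \<delta> / 2 * real n ^ 3"
        using cd \<delta>(1) by (intro mult_left_mono power_mono) auto
      finally have "real (card (cherries U E)) \<le> \<delta> / 2 * real n ^ 3" .
      moreover have "real (card (cherries V E)) \<le> real (card (cherries U E) + 3 * (card (V - U) * (card V)\<^sup>2))"
        by (intro of_nat_mono card_cherries_delete[OF fin U(1)])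
      \<comment> \<open>Each deleted vertex lies in at most \<open>3 * n\<^sup>2\<close> cherries,
        so the deletion destroys at most half of \<open>\<delta> n\<^sup>3\<close> cherries, and the
        spectral bound lets at most the other half survive.\<close>
      moreover have "3 * (real (card (V - U)) * (real n)\<^sup>2) \<le> \<delta> / 2 * real n ^ 3"
      proof -
        have "real (card (V - U)) * (real n)\<^sup>2 \<le> \<delta> * real n / 6 * (real n)\<^sup>2"
          using U(2) kle by (intro mult_right_mono) auto
        then show ?thesis by (simp add: power2_eq_square power3_eq_cube)
      qed
      ultimately show False using many cardV by simp
    qed
    obtain x :: "nat \<Rightarrow> 'a \<Rightarrow> real" where x: "\<And>l. l < k \<Longrightarrow> ip V (x l) (x l) = 1"
      "\<And>l. l < k \<Longrightarrow> quad_form V A (x l) \<le> - \<mu>" "\<And>i. i \<in> V \<Longrightarrow> (\<Sum>l<k. (x l i)\<^sup>2) \<le> 2"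
      using greedy_negative_vectors[OF fin neg, of k k] by auto
    have "real k \<ge> \<delta> * real n / 6 - 1" using \<delta>(1) by (simp add: k_def)
    then have \<mu>k: "\<mu> * (\<delta> * real n / 6 - 1) \<le> \<mu> * real k" using \<mu> by (intro mult_left_mono) auto
    have "\<exists>s. (\<forall>i\<in>V. s i = 1 \<or> s i = - 1) \<and>
      - quad_form V A s \<ge> (\<mu> * real k - 9 * real (card V)) / (2 * ln (16 * (real (card V))\<^sup>2))\<^sup>2"
      by (rule exists_negative_sign_vector[OF fin ne _ _ x])
         (use big(2) \<mu>k cardV irr in \<open>auto simp: A_def \<mu>_def\<close>)
    then obtain s where s: "\<forall>i\<in>V. s i = 1 \<or> s i = - 1"
      "- quad_form V A s \<ge> (\<mu> * real k - 9 * real n) / (2 * ln (16 * (real n)\<^sup>2))\<^sup>2"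
      unfolding cardV by blast
    have "real n powr (1 + 1 / 100) \<le> (\<mu> * (\<delta> * real n / 6 - 1) - 9 * real n) / (2 * ln (16 * (real n)\<^sup>2))\<^sup>2 / 4"
      using big(3) by (simp add: \<mu>_def)
    also have "\<dots> \<le> (\<mu> * real k - 9 * real n) / (2 * ln (16 * (real n)\<^sup>2))\<^sup>2 / 4"
      using \<mu>k by (intro divide_right_mono) auto
    also have "\<dots> \<le> - quad_form V A s / 4" using s(2) by simp
    also have "\<dots> \<le> surplus G"
      using surplus_ge_quad_form[OF G, of s] s(1) unfolding V_def A_def[abs_def] E_def by simp
    finally show "surplus G \<ge> real n powr (1 + 1 / 100)" .
  qed
qed

end
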